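(* Let $\alpha$ be a curve of a pants decomposition of a closed orientable surface of genus at least $2$. (1) Suppose $(2\ell,2\tau)\in\mathbb R^+\times\mathbb R$ are the Fenchel–Nielsen coordinates at $\alpha$ of a hyperbolic metric. Then the triangle lengths $(a,b,c)$ at $\alpha$ are given by $$a=\ell,\qquad b=\cosh^{-1}(\cosh\tau\,\coth\ell),\qquad c=\cosh^{-1}(\cosh(\ell-\tau)\coth\ell),$$ and the collar parameters $(x,y)$ at $\alpha$ are given by $$x=4\ell-2\cosh^{-1}(\cosh\tau\coth\ell)-2\cosh^{-1}(\cosh(\ell-\tau)\coth\ell),$$ $$y=2\cosh^{-1}(\cosh\tau\coth\ell)-2\cosh^{-1}(\cosh(\ell-\tau)\coth\ell).$$ (2) If $(2\ell,2\tau)\in\mathbb R_{\ge0}\times\mathbb R$ are the Dehn–Thurston coordinates at $\alpha$ of a measured foliation, then the triangle lengths at $\alpha$ are $a=\ell$, $b=|\tau|$, $c=|\ell-\tau|$, and the collar parameters are $$x=4\ell-2|\tau|-2|\ell-\tau|,\qquad y=2|\tau|-2|\ell-\tau|.$$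
   Context: **Standard annulus.** $S^1=\mathbb R/2\mathbb Z$, $\mathbb A=S^1\times[-1,1]$, $p:\mathbb R\times[-1,1]\to\mathbb A$ is the universal covering. The basepoints on $\partial\mathbb A$ are $p(1,\pm1)$. An annulus neighbourhood $A$ of $\alpha$ is identified with $\mathbb A$, with $\alpha=S^1\times0$, so that $p(1,\pm1)$ are endpoints of seams of the pairs of pants on the two sides (a seam of a pair of pants is one of the three fixed arcs of its structure-preserving reflection, one joining each pair of boundary components; each boundary component of $A$ contains two seam endpoints, $p(0,\pm1)$ and $p(1,\pm1)$). **Triangle lengths, hyperbolic case.** In a hyperbolic metric $\alpha$ is a closed geodesic of length $2a$ and $A$ is its standard collar: the set of points within distance $\kappa(a)=\sinh^{-1}(1/\sinh a)$ of $\alpha$. In the collar let $\beta$ be the geodesic arc homotopic rel endpoints to $t\mapsto p(-1,t)=p(1,t)$, $t\in[-1,1]$, and $\gamma$ the geodesic arc homotopic rel endpoints to $t\mapsto p(t,t)$, $t\in[-1,1]$. The triangle lengths are $(a,b,c)$ where $2a,2b,2c$ are the lengths of $\alpha,\beta,\gamma$. **Triangle lengths, measured foliation case.** In a (standard) measured foliation the foliation on $A\equiv\mathbb A$ is linear, i.e. covered by $|\omega|$ for a constant-coefficient linear 1-form $\omega$ on $\mathbb R\times[-1,1]$. The triangle lengths are the transverse measures $a,b,c$ of $p([0,1]\times0)$, $p(1\times[0,1])$ and $p(\{(t,t):0\le t\le1\})$. **Collar parameters.** In both cases the collar parameters are $(x,y)=\pi(a,b,c)=(4a-2b-2c,\,2b-2c)$.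 **Fenchel–Nielsen coordinates at $\alpha$.** $2\ell$ is the length of the geodesic $\alpha$, and $2\tau$ is the twist, measured as a length: the signed displacement along $\alpha$ between the seams on its two sides. Explicitly, lift $\beta$ to the universal cover of the collar, and project its endpoints orthogonally to the lift of $\alpha$; the displacement from the projection of the initial endpoint (lying over $p(-1,-1)$) to that of the terminal endpoint is $-2\tau$, where displacement is positive in the direction of increasing first coordinate of $\mathbb R\times[-1,1]$. **Dehn–Thurston coordinates at $\alpha$.** $2\ell\ge0$ is the transverse measure of $\alpha$, and $2\tau$ is the twist: the signed transverse measure across $A$ between the seams, so that $2|\tau|$ is the transverse measure of $p(1\times[-1,1])$. If $\ell>0$ and $\omega$ is chosen with $\omega(\partial/\partial x)>0$, the sign is such that $\int_{1\times[-1,1]}\omega=-2\tau$. If $\ell=0$, $\tau$ and $-\tau$ define the same foliation. *)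

theory Defs
  imports "HOL-Analysis.Analysis" "HOL-Homology.Homology"
begin

section \<open>The standard annulus and the standard pair of pants\<close>

(* The circle R/2Z is modelled by the unit circle of the complex plane through x |-> exp(i pi x). *)

definition strip :: "(real \<times> real) set" where
  "strip = UNIV \<times> {-1..1}"

definition std_annulus :: "(complex \<times> real) set" where
  "std_annulus = sphere 0 1 \<times> {-1..1}"

definition ann_cover :: "real \<times> real \<Rightarrow> complex \<times> real" where
  "ann_cover = (\<lambda>(x, t). (cis (pi * x), t))"

definition ann_circle :: "real \<Rightarrow> (complex \<times> real) set" where
  "ann_circle t = sphere 0 1 \<times> {t}"

(* A round disc with two round holes.  Complex conjugation is a reflection mapping each boundary
   circle to itself; its fixed point set consists of the three seams [-4,-3], [-1,1], [3,4]. *)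

definition std_pants :: "complex set" where
  "std_pants = {z. cmod z \<le> 4 \<and> cmod (z - 2) \<ge> 1 \<and> cmod (z + 2) \<ge> 1}"

definition std_pants_boundary :: "complex set" where
  "std_pants_boundary = {z \<in> std_pants. cmod z = 4 \<or> cmod (z - 2) = 1 \<or> cmod (z + 2) = 1}"

definition std_seams :: "complex set" where
  "std_seams = {z \<in> std_pants. cnj z = z}"


section \<open>Surfaces and pants decompositions\<close>

(* For a closed connected surface, orientability means having a fundamental class, and the genus
   is half of the first Betti number. *)

definition closed_orientable_surface :: "'a::t2_space set \<Rightarrow> nat \<Rightarrow> bool" where
  "closed_orientable_surface S g \<longleftrightarrow>
     S \<noteq> {} \<and> compact S \<and> connected S \<and>
     (\<forall>x\<in>S. \<exists>U. openin (top_of_set S) U \<and> x \<in> U \<and> U homeomorphic (ball 0 1 :: complex set)) \<and>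
     homology_group 2 (top_of_set S) \<cong> integer_group \<and>
     homology_group 1 (top_of_set S) \<cong> free_Abelian_group {..<2 * g}"

(* S is cut into n annuli h 0, ..., h (n-1), which are neighbourhoods of the curves of the pants
   decomposition, and m pairs of pants Q 0, ..., Q (m-1), glued along boundary circles.  The i-th
   curve is h i ` ann_circle 0, and h i is the identification of its annulus neighbourhood with
   the standard annulus.  The last clause says that on each boundary circle of an annulus the
   endpoints of seams of the adjacent pair of pants are the images of p(0,e) and p(1,e). *)

definition pants_decomposition ::
  "'a::t2_space set \<Rightarrow> nat \<Rightarrow> (nat \<Rightarrow> complex \<times> real \<Rightarrow> 'a) \<Rightarrow> nat \<Rightarrow> (nat \<Rightarrow> complex \<Rightarrow> 'a) \<Rightarrow> bool" where
  "pants_decomposition S n h m Q \<longleftrightarrow>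
     (\<forall>i<n. continuous_on std_annulus (h i) \<and> inj_on (h i) std_annulus) \<and>
     (\<forall>j<m. continuous_on std_pants (Q j) \<and> inj_on (Q j) std_pants) \<and>
     S = (\<Union>i<n. h i ` std_annulus) \<union> (\<Union>j<m. Q j ` std_pants) \<and>
     (\<forall>i<n. \<forall>i'<n. i \<noteq> i' \<longrightarrow> h i ` std_annulus \<inter> h i' ` std_annulus = {}) \<and>
     (\<forall>j<m. \<forall>j'<m. j \<noteq> j' \<longrightarrow> Q j ` std_pants \<inter> Q j' ` std_pants = {}) \<and>
     (\<forall>i<n. \<forall>j<m. h i ` std_annulus \<inter> Q j ` std_pants
                    \<subseteq> h i ` (ann_circle (-1) \<union> ann_circle 1) \<inter> Q j ` std_pants_boundary) \<and>
     (\<forall>i<n. \<forall>e\<in>{-1, 1}. h i ` ann_circle e \<inter> (\<Union>j<m. Q j ` std_seams)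
                    = {h i (ann_cover (0, e)), h i (ann_cover (1, e))})"


section \<open>Hyperbolic metrics\<close>

definition H2 :: "complex set" where
  "H2 = {z. Im z > 0}"

definition hdist :: "complex \<Rightarrow> complex \<Rightarrow> real" where
  "hdist z w = arcosh (1 + (cmod (z - w))\<^sup>2 / (2 * Im z * Im w))"

definition H2_isometry :: "(complex \<Rightarrow> complex) \<Rightarrow> bool" where
  "H2_isometry f \<longleftrightarrow> bij_betw f H2 H2 \<and> (\<forall>z\<in>H2. \<forall>w\<in>H2. hdist (f z) (f w) = hdist z w)"

(* A hyperbolic metric on a closed surface S is given by its Riemannian universal covering
   q : H2 -> S, i.e. it exhibits S as the quotient of H2 by a group of isometries.  (On an
   orientable surface these isometries automatically preserve orientation.) *)

definition hyperbolic_metric :: "'a::t2_space set \<Rightarrow> (complex \<Rightarrow> 'a) \<Rightarrow> bool" where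
  "hyperbolic_metric S q \<longleftrightarrow>
     covering_space H2 q S \<and>
     (\<forall>z\<in>H2. \<forall>w\<in>H2. q z = q w \<longrightarrow>
        (\<exists>f. H2_isometry f \<and> (\<forall>u\<in>H2. q (f u) = q u) \<and> f z = w))"

definition surface_dist :: "(complex \<Rightarrow> 'a) \<Rightarrow> 'a \<Rightarrow> 'a \<Rightarrow> real" where
  "surface_dist q x y = Inf {hdist z w | z w. z \<in> H2 \<and> w \<in> H2 \<and> q z = x \<and> q w = y}"

definition geodesic_line :: "(real \<Rightarrow> complex) \<Rightarrow> bool" where
  "geodesic_line \<sigma> \<longleftrightarrow> range \<sigma> \<subseteq> H2 \<and> (\<forall>s t. hdist (\<sigma> s) (\<sigma> t) = \<bar>s - t\<bar>)"

definition closed_geodesic :: "(complex \<Rightarrow> 'a) \<Rightarrow> 'a set \<Rightarrow> real \<Rightarrow> bool" where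
  "closed_geodesic q C L \<longleftrightarrow> L > 0 \<and>
     (\<exists>\<sigma>. geodesic_line \<sigma> \<and> C = range (q \<circ> \<sigma>) \<and>
        (\<forall>s t. q (\<sigma> s) = q (\<sigma> t) \<longleftrightarrow> (\<exists>k::int. s - t = of_int k * L)))"

(* A geodesic arc of length L, parametrised on [0,1] with constant speed. *)

definition geodesic_arc :: "(complex \<Rightarrow> 'a) \<Rightarrow> (real \<Rightarrow> 'a) \<Rightarrow> real \<Rightarrow> bool" where
  "geodesic_arc q g L \<longleftrightarrow>
     (\<exists>\<sigma>. (\<forall>s\<in>{0..1}. \<sigma> s \<in> H2 \<and> q (\<sigma> s) = g s) \<and>
          (\<forall>s\<in>{0..1}. \<forall>t\<in>{0..1}. hdist (\<sigma> s) (\<sigma> t) = L * \<bar>s - t\<bar>))"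

definition coth :: "real \<Rightarrow> real" where
  "coth x = cosh x / sinh x"

definition collar_width :: "real \<Rightarrow> real" where
  "collar_width a = arsinh (1 / sinh a)"

(* The metric in standard position with respect to the pants decomposition: the curves are closed
   geodesics, the annuli are their standard collars, and the reflection of each pair of pants is
   a local isometry. *)

definition standard_hyperbolic_metric ::
  "'a::t2_space set \<Rightarrow> nat \<Rightarrow> (nat \<Rightarrow> complex \<times> real \<Rightarrow> 'a) \<Rightarrow> nat \<Rightarrow> (nat \<Rightarrow> complex \<Rightarrow> 'a) \<Rightarrow>
     (complex \<Rightarrow> 'a) \<Rightarrow> bool" where
  "standard_hyperbolic_metric S n h m Q q \<longleftrightarrow>
     hyperbolic_metric S q \<and>
     (\<forall>i<n. \<exists>a. closed_geodesic q (h i ` ann_circle 0) (2 * a) \<and>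
        h i ` std_annulus =
          {x \<in> S. \<exists>y \<in> h i ` ann_circle 0. surface_dist q x y \<le> collar_width a}) \<and>
     (\<forall>j<m. \<forall>z\<in>std_pants. \<exists>r>0. \<forall>z1\<in>std_pants. \<forall>z2\<in>std_pants.
        surface_dist q (Q j z) (Q j z1) < r \<and> surface_dist q (Q j z) (Q j z2) < r \<longrightarrow>
        surface_dist q (Q j (cnj z1)) (Q j (cnj z2)) = surface_dist q (Q j z1) (Q j z2))"

(* The paths t |-> p(1,t) and t |-> p(t,t), t in [-1,1], reparametrised on [0,1]. *)

definition beta_path :: "(complex \<times> real \<Rightarrow> 'a) \<Rightarrow> real \<Rightarrow> 'a" where
  "beta_path h = (\<lambda>s. h (ann_cover (1, 2 * s - 1)))"

definition gamma_path :: "(complex \<times> real \<Rightarrow> 'a) \<Rightarrow> real \<Rightarrow> 'a" where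
  "gamma_path h = (\<lambda>s. h (ann_cover (2 * s - 1, 2 * s - 1)))"

(* g is a geodesic arc of length L in the collar, homotopic there to g0 relative to endpoints. *)

definition geodesic_rep ::
  "(complex \<Rightarrow> 'a::t2_space) \<Rightarrow> (complex \<times> real \<Rightarrow> 'a) \<Rightarrow> (real \<Rightarrow> 'a) \<Rightarrow> (real \<Rightarrow> 'a) \<Rightarrow> real \<Rightarrow> bool" where
  "geodesic_rep q h g0 g L \<longleftrightarrow>
     geodesic_arc q g L \<and> homotopic_paths (h ` std_annulus) g g0"

definition hyp_triangle_lengths ::
  "(complex \<Rightarrow> 'a::t2_space) \<Rightarrow> (complex \<times> real \<Rightarrow> 'a) \<Rightarrow> real \<times> real \<times> real \<Rightarrow> bool" where
  "hyp_triangle_lengths q h = (\<lambda>(a, b, c).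
     closed_geodesic q (h ` ann_circle 0) (2 * a) \<and>
     (\<exists>\<beta>. geodesic_rep q h (beta_path h) \<beta> (2 * b)) \<and>
     (\<exists>\<gamma>. geodesic_rep q h (gamma_path h) \<gamma> (2 * c)))"

(* The point \<sigma> s is the foot of the perpendicular from z to \<sigma>.  Since the upper half-plane is
   a conformal model, hyperbolic and Euclidean orthogonality agree. *)

definition perpendicular_foot :: "(real \<Rightarrow> complex) \<Rightarrow> complex \<Rightarrow> real \<Rightarrow> bool" where
  "perpendicular_foot \<sigma> z s \<longleftrightarrow>
     (\<exists>\<rho> u. geodesic_line \<rho> \<and> \<rho> 0 = \<sigma> s \<and> \<rho> u = z \<and>
        vector_derivative \<rho> (at 0) \<bullet> vector_derivative \<sigma> (at s) = 0)"

(* The universal cover of the collar is the strip; F develops it into H2.  \<beta>' is a lift of \<beta> to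
   the strip, and \<sigma> is the lift of the core curve, parametrised by arc length in the direction of
   increasing first coordinate. *)

definition fenchel_nielsen ::
  "(complex \<Rightarrow> 'a::t2_space) \<Rightarrow> (complex \<times> real \<Rightarrow> 'a) \<Rightarrow> real \<times> real \<Rightarrow> bool" where
  "fenchel_nielsen q h = (\<lambda>(L, T).
     closed_geodesic q (h ` ann_circle 0) L \<and>
     (\<exists>\<beta> d F \<beta>' \<sigma> \<theta> s0 s1.
        geodesic_rep q h (beta_path h) \<beta> d \<and>
        continuous_on strip F \<and> (\<forall>z\<in>strip. F z \<in> H2 \<and> q (F z) = h (ann_cover z)) \<and>
        path \<beta>' \<and> path_image \<beta>' \<subseteq> strip \<and> (\<forall>s\<in>{0..1}. h (ann_cover (\<beta>' s)) = \<beta> s) \<and>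
        geodesic_line \<sigma> \<and> strict_mono \<theta> \<and> surj \<theta> \<and> (\<forall>x. F (x, 0) = \<sigma> (\<theta> x)) \<and>
        perpendicular_foot \<sigma> (F (pathstart \<beta>')) s0 \<and>
        perpendicular_foot \<sigma> (F (pathfinish \<beta>')) s1 \<and>
        s1 - s0 = - T))"


section \<open>Measured foliations\<close>

definition path_variation :: "(real \<Rightarrow> real) \<Rightarrow> ereal" where
  "path_variation f =
     (SUP ts \<in> {ts. sorted ts \<and> set ts \<subseteq> {0..1}}.
        ereal (\<Sum>i<length ts - 1. \<bar>f (ts ! Suc i) - f (ts ! i)\<bar>))"

(* A measured foliation is given by its transverse measure \<mu>, a function on all paths in S which is
   additive under subdivision.  Each point of S has a coordinate disc \<psi> centred at it in which \<mu> is
   (i) the measure |Im d(\<psi>^(k/2))| of a k-pronged singularity (k = 2: a regular point; along a path,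
   w is a branch of \<psi>^(k/2)), or
   (ii) zero on the lower half-disc and |Im d(\<psi>^l)| on the upper half-disc, or
   (iii) zero.
   The last two cases allow a foliation to be supported on a subsurface, with boundary composed of
   leaves; e.g. the annulus at a curve with Dehn-Thurston coordinates (0,0) is not foliated. *)

definition measured_foliation :: "'a::t2_space set \<Rightarrow> ((real \<Rightarrow> 'a) \<Rightarrow> ereal) \<Rightarrow> bool" where
  "measured_foliation S \<mu> \<longleftrightarrow>
     (\<forall>g. path g \<and> path_image g \<subseteq> S \<longrightarrow>
        0 \<le> \<mu> g \<and> (\<forall>t\<in>{0..1}. \<mu> g = \<mu> (\<lambda>s. g (t * s)) + \<mu> (\<lambda>s. g (t + (1 - t) * s)))) \<and>
     (\<forall>x\<in>S. \<exists>U \<psi> \<psi>'. openin (top_of_set S) U \<and> x \<in> U \<and>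
        homeomorphism U (ball (0::complex) 1) \<psi> \<psi>' \<and> \<psi> x = 0 \<and>
        ((\<exists>k\<ge>2. \<forall>g w. path g \<and> path_image g \<subseteq> U \<and>
             continuous_on {0..1} w \<and> (\<forall>s\<in>{0..1}. (w s)\<^sup>2 = \<psi> (g s) ^ k) \<longrightarrow>
             \<mu> g = path_variation (\<lambda>s. Im (w s))) \<or>
         (\<exists>l\<ge>1. \<forall>g. path g \<and> path_image g \<subseteq> U \<longrightarrow>
             \<mu> g = path_variation (\<lambda>s. if Im (\<psi> (g s)) \<ge> 0 then Im (\<psi> (g s) ^ l) else 0)) \<or>
         (\<forall>g. path g \<and> path_image g \<subseteq> U \<longrightarrow> \<mu> g = 0)))"

(* The value at time s along g of the constant-coefficient 1-form u dx + v dt. *)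

definition form_along :: "real \<Rightarrow> real \<Rightarrow> (real \<Rightarrow> real \<times> real) \<Rightarrow> real \<Rightarrow> real" where
  "form_along u v g s =
     u * fst (vector_derivative g (at s)) + v * snd (vector_derivative g (at s))"

(* On the annulus h the foliation is covered by |u dx + v dt|. *)

definition covered_by_form ::
  "(complex \<times> real \<Rightarrow> 'a) \<Rightarrow> ((real \<Rightarrow> 'a) \<Rightarrow> ereal) \<Rightarrow> real \<Rightarrow> real \<Rightarrow> bool" where
  "covered_by_form h \<mu> u v \<longleftrightarrow>
     (\<forall>g. valid_path g \<and> path_image g \<subseteq> strip \<longrightarrow>
        \<mu> (h \<circ> ann_cover \<circ> g) = ereal (integral {0..1} (\<lambda>s. \<bar>form_along u v g s\<bar>)))"

definition standard_measured_foliation ::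
  "'a::t2_space set \<Rightarrow> nat \<Rightarrow> (nat \<Rightarrow> complex \<times> real \<Rightarrow> 'a) \<Rightarrow> nat \<Rightarrow> (nat \<Rightarrow> complex \<Rightarrow> 'a) \<Rightarrow>
     ((real \<Rightarrow> 'a) \<Rightarrow> ereal) \<Rightarrow> bool" where
  "standard_measured_foliation S n h m Q \<mu> \<longleftrightarrow>
     measured_foliation S \<mu> \<and>
     (\<forall>i<n. \<exists>u v. covered_by_form (h i) \<mu> u v) \<and>
     (\<forall>j<m. \<forall>g. path g \<and> path_image g \<subseteq> std_pants \<longrightarrow> \<mu> (Q j \<circ> cnj \<circ> g) = \<mu> (Q j \<circ> g))"

definition mf_triangle_lengths ::
  "((real \<Rightarrow> 'a) \<Rightarrow> ereal) \<Rightarrow> (complex \<times> real \<Rightarrow> 'a) \<Rightarrow> real \<times> real \<times> real \<Rightarrow> bool" where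
  "mf_triangle_lengths \<mu> h = (\<lambda>(a, b, c).
     \<mu> (\<lambda>s. h (ann_cover (s, 0))) = ereal a \<and>
     \<mu> (\<lambda>s. h (ann_cover (1, s))) = ereal b \<and>
     \<mu> (\<lambda>s. h (ann_cover (s, s))) = ereal c)"

definition dehn_thurston ::
  "((real \<Rightarrow> 'a) \<Rightarrow> ereal) \<Rightarrow> (complex \<times> real \<Rightarrow> 'a) \<Rightarrow> real \<times> real \<Rightarrow> bool" where
  "dehn_thurston \<mu> h = (\<lambda>(L, T).
     \<mu> (\<lambda>s. h (ann_cover (2 * s, 0))) = ereal L \<and>
     \<mu> (\<lambda>s. h (ann_cover (1, 2 * s - 1))) = ereal \<bar>T\<bar> \<and>
     (L > 0 \<longrightarrow> (\<exists>u v. covered_by_form h \<mu> u v \<and> u > 0 \<and>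
        integral {0..1} (form_along u v (\<lambda>s. (1, 2 * s - 1))) = - T)))"


section \<open>Collar parameters\<close>

definition collar_map :: "real \<times> real \<times> real \<Rightarrow> real \<times> real" where
  "collar_map = (\<lambda>(a, b, c). (4 * a - 2 * b - 2 * c, 2 * b - 2 * c))"

definition hyp_collar_parameters ::
  "(complex \<Rightarrow> 'a::t2_space) \<Rightarrow> (complex \<times> real \<Rightarrow> 'a) \<Rightarrow> real \<times> real \<Rightarrow> bool" where
  "hyp_collar_parameters q h xy \<longleftrightarrow> (\<exists>abc. hyp_triangle_lengths q h abc \<and> xy = collar_map abc)"

definition mf_collar_parameters ::
  "((real \<Rightarrow> 'a) \<Rightarrow> ereal) \<Rightarrow> (complex \<times> real \<Rightarrow> 'a) \<Rightarrow> real \<times> real \<Rightarrow> bool" where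
  "mf_collar_parameters \<mu> h xy \<longleftrightarrow> (\<exists>abc. mf_triangle_lengths \<mu> h abc \<and> xy = collar_map abc)"

end

theory Submission
  imports Defs
begin

text \<open>
  In the foliated case everything is the integral of a constant 1-form along a straight segment.

  In the hyperbolic case, develop the universal cover of the collar into the upper half-plane so that
  the core goes to the imaginary axis; the collar then goes to the Euclidean cone
  \<open>|Re z| \<le> K Im z\<close> with \<open>K = 1 / sinh l\<close>. The developing map \<open>F\<close> is injective and has a continuous
  section over the cone, so by invariance of domain it sends the two boundary lines of the strip to the
  two sides of the cone. Since the cone is geodesically convex, the geodesic representative of a path
  \<open>p \<circ> linepath z w\<close> exists and has length \<open>hdist (F z) (F w)\<close>. For points on
  opposite sides of the cone whose feet on the axis are \<open>2 t\<close> apart the distance \<open>D\<close> satisfies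
  \<open>cosh D = (1 + K\<^sup>2) cosh (2 t) + K\<^sup>2\<close>, that is \<open>cosh (D / 2) = cosh t coth l\<close>; the feet of the
  endpoints are \<open>2 \<tau>\<close> apart for \<open>\<beta>\<close> and \<open>2 (l - \<tau>)\<close> apart for \<open>\<gamma>\<close>.
\<close>

subsection \<open>The upper half-plane\<close>

text \<open>The metric enters only through the covering \<open>q\<close> and distances, and
  \<open>h\<close> is merely topological. The period of the core and the position of the collar must
  therefore be extracted from distances and from uniqueness of lifts. Deck transformations are used
  as isometries, never as explicit matrices: distances to points of the axis determine |z| and Im z,
  but Re z only up to sign. This is enough, because the cone is symmetric in the axis and the foot
  of z depends on |z| alone. Likewise \<open>F\<close> may reverse orientation; what matters is that
  the two boundary lines go to opposite rays. The slope K is sinh of the collar width, and 1 + K^2 =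
  coth^2 l is the origin of coth in the result. The path of \<gamma> starts at (-1, -1), one period
  2 l behind the start of \<beta>; as the feet of \<beta> are displaced by -2 \<tau>, those of
  \<gamma> are displaced by 2 l - 2 \<tau>. Lengths are given by predicates, so each formula is
  proved as an equivalence: a representative of that length exists, and every representative has
  that length.\<close>

lemma H2_Im_pos: "z \<in> H2 \<Longrightarrow> Im z > 0"
  by (simp add: H2_def)

lemma norm_diff_sq: "(cmod (z - w))\<^sup>2 = (cmod z)\<^sup>2 + (cmod w)\<^sup>2 - 2 * Re z * Re w - 2 * Im z * Im w"
  unfolding cmod_power2 by (simp add: power2_eq_square algebra_simps)

lemma cosh_hdist:
  assumes "z \<in> H2" "w \<in> H2"
  shows "cosh (hdist z w) = ((cmod z)\<^sup>2 + (cmod w)\<^sup>2 - 2 * Re z * Re w) / (2 * Im z * Im w)"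
proof -
  have p: "Im z > 0" "Im w > 0" using assms by (auto simp: H2_def)
  have "1 \<le> 1 + (cmod (z - w))\<^sup>2 / (2 * Im z * Im w)"
    using p by simp
  then have "cosh (hdist z w) = 1 + (cmod (z - w))\<^sup>2 / (2 * Im z * Im w)"
    unfolding hdist_def by (rule cosh_arcosh_real)
  also have "\<dots> = ((cmod z)\<^sup>2 + (cmod w)\<^sup>2 - 2 * Re z * Re w) / (2 * Im z * Im w)"
    unfolding norm_diff_sq using p by (simp add: field_simps)
  finally show ?thesis .
qed

lemma norm_diff_hdist:
  assumes "z \<in> H2" "w \<in> H2"
  shows "(cmod (z - w))\<^sup>2 = 2 * Im z * Im w * (cosh (hdist z w) - 1)"
  using H2_Im_pos[OF assms(1)] H2_Im_pos[OF assms(2)]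
  by (simp add: cosh_hdist[OF assms] norm_diff_sq field_simps)

lemma hdist_nonneg: "z \<in> H2 \<Longrightarrow> w \<in> H2 \<Longrightarrow> hdist z w \<ge> 0"
  unfolding hdist_def by (intro arcosh_nonneg_real) (auto simp: H2_def)

lemma hdist_sym: "hdist z w = hdist w z"
  unfolding hdist_def by (simp add: norm_minus_commute mult_ac)

lemma hdist_self [simp]: "hdist z z = 0"
  by (simp add: hdist_def)

lemma hdist_eqI:
  assumes "z \<in> H2" "w \<in> H2" "0 \<le> L" "cosh (hdist z w) = cosh L"
  shows "hdist z w = L"
  using assms hdist_nonneg by (metis arcosh_cosh_real)

text \<open>Controls Euclidean distance by hyperbolic distance and Im z alone: the unknown Im w is
  at most Im z + D, and the resulting term k * D is absorbed by 2 k D \<le> k^2 + D^2.\<close>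

lemma norm_diff_le_hdist:
  assumes "z \<in> H2" "w \<in> H2" and k: "k = 2 * Im z * (cosh (hdist z w) - 1)"
  shows "(cmod (z - w))\<^sup>2 \<le> 2 * k * Im z + k\<^sup>2"
proof -
  define D where "D = cmod (z - w)"
  have k0: "k \<ge> 0" using H2_Im_pos[OF assms(1)] cosh_real_ge_1[of "hdist z w"] by (simp add: k)
  have "Im w \<le> Im z + D"
    using abs_Im_le_cmod[of "z - w"] by (simp add: D_def)
  then have "k * Im w \<le> k * (Im z + D)" using k0 by (rule mult_left_mono)
  moreover have "D\<^sup>2 = k * Im w" by (simp add: D_def k norm_diff_hdist[OF assms(1,2)])
  moreover have "2 * (k * D) \<le> k\<^sup>2 + D\<^sup>2" using sum_squares_bound[of k D] by simp
  ultimately show ?thesis unfolding D_def[symmetric] by (simp add: algebra_simps)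
qed

text \<open>Geodesics and isometries are specified by \<open>hdist\<close>, whereas continuity is
  Euclidean; the preceding bound passes from one to the other, since k tends to 0 with the
  hyperbolic distance.\<close>

lemma continuous_on_hdistI:
  fixes G :: "'b::metric_space \<Rightarrow> complex"
  assumes G: "\<And>x. x \<in> T \<Longrightarrow> G x \<in> H2"
    and lim: "\<And>x. x \<in> T \<Longrightarrow> ((\<lambda>y. hdist (G x) (G y)) \<longlongrightarrow> 0) (at x within T)"
  shows "continuous_on T G"
  unfolding continuous_on_def
proof
  fix x assume x: "x \<in> T"
  define k where "k = (\<lambda>y. 2 * Im (G x) * (cosh (hdist (G x) (G y)) - 1))"
  have "(k \<longlongrightarrow> 2 * Im (G x) * (cosh 0 - 1)) (at x within T)"
    unfolding k_def by (intro tendsto_intros lim x)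
  then have k: "(k \<longlongrightarrow> 0) (at x within T)" by simp
  have "((\<lambda>y. sqrt (2 * k y * Im (G x) + (k y)\<^sup>2)) \<longlongrightarrow> sqrt (2 * 0 * Im (G x) + 0\<^sup>2)) (at x within T)"
    by (intro tendsto_intros k)
  then have l: "((\<lambda>y. sqrt (2 * k y * Im (G x) + (k y)\<^sup>2)) \<longlongrightarrow> 0) (at x within T)" by simp
  have "\<forall>\<^sub>F y in at x within T. norm (G y - G x) \<le> sqrt (2 * k y * Im (G x) + (k y)\<^sup>2)"
    unfolding eventually_at_filter
  proof (intro always_eventually allI impI)
    fix y assume "y \<in> T"
    have "norm (G y - G x) = sqrt ((cmod (G x - G y))\<^sup>2)" by (simp add: norm_minus_commute)
    also have "\<dots> \<le> sqrt (2 * k y * Im (G x) + (k y)\<^sup>2)"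
      using norm_diff_le_hdist[OF G[OF x] G[OF \<open>y \<in> T\<close>], of "k y"] by (intro real_sqrt_le_mono) (simp add: k_def)
    finally show "norm (G y - G x) \<le> sqrt (2 * k y * Im (G x) + (k y)\<^sup>2)" .
  qed
  from Lim_null_comparison[OF this l] show "(G \<longlongrightarrow> G x) (at x within T)"
    using Lim_null by blast
qed

lemma continuous_on_constant_speed:
  assumes "\<And>s. s \<in> T \<Longrightarrow> \<sigma> s \<in> H2" and d: "\<And>s t. s \<in> T \<Longrightarrow> t \<in> T \<Longrightarrow> hdist (\<sigma> s) (\<sigma> t) = v * \<bar>s - t\<bar>"
  shows "continuous_on T \<sigma>"
proof (rule continuous_on_hdistI)
  fix x assume x: "x \<in> T"
  have "((\<lambda>y. v * \<bar>x - y\<bar>) \<longlongrightarrow> v * \<bar>x - x\<bar>) (at x within T)" by (intro tendsto_intros)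
  then have "((\<lambda>y. v * \<bar>x - y\<bar>) \<longlongrightarrow> 0) (at x within T)" by simp
  moreover have "\<forall>\<^sub>F y in at x within T. v * \<bar>x - y\<bar> = hdist (\<sigma> x) (\<sigma> y)"
    using d[OF x] by (auto simp: eventually_at_filter)
  ultimately show "((\<lambda>y. hdist (\<sigma> x) (\<sigma> y)) \<longlongrightarrow> 0) (at x within T)"
    by (rule Lim_transform_eventually)
qed (use assms in auto)

lemma continuous_on_hdist:
  assumes "z \<in> H2" shows "continuous_on H2 (hdist z)"
  unfolding hdist_def
  by (rule continuous_on_compose2[OF continuous_on_arcosh[OF order_refl]], intro continuous_intros)
    (use assms in \<open>auto simp: H2_def\<close>)

section \<open>Isometries of the upper half-plane\<close>

lemma H2_isometryD:
  assumes "H2_isometry f"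
  shows "z \<in> H2 \<Longrightarrow> f z \<in> H2" "z \<in> H2 \<Longrightarrow> w \<in> H2 \<Longrightarrow> hdist (f z) (f w) = hdist z w"
  using assms by (auto simp: H2_isometry_def bij_betw_def)

lemma H2_isometry_continuous:
  assumes "H2_isometry f" shows "continuous_on H2 f"
proof (rule continuous_on_hdistI)
  fix x assume x: "x \<in> H2"
  have "(hdist x \<longlongrightarrow> hdist x x) (at x within H2)"
    using continuous_on_hdist[OF x] x by (auto simp: continuous_on_def)
  then have "(hdist x \<longlongrightarrow> 0) (at x within H2)" by simp
  moreover have "\<forall>\<^sub>F y in at x within H2. hdist x y = hdist (f x) (f y)"
    using H2_isometryD(2)[OF assms x] by (auto simp: eventually_at_filter)
  ultimately show "((\<lambda>y. hdist (f x) (f y)) \<longlongrightarrow> 0) (at x within H2)"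
    by (rule Lim_transform_eventually)
qed (use H2_isometryD[OF assms] in auto)

lemma H2_isometry_comp: "H2_isometry f \<Longrightarrow> H2_isometry f' \<Longrightarrow> H2_isometry (f \<circ> f')"
  using bij_betw_trans[of f' H2 H2 f H2] H2_isometryD[of f] H2_isometryD[of f']
  by (simp add: H2_isometry_def)

lemma H2_isometry_inverse:
  assumes "H2_isometry f"
  obtains f' where "H2_isometry f'" "\<And>z. z \<in> H2 \<Longrightarrow> f' (f z) = z" "\<And>z. z \<in> H2 \<Longrightarrow> f (f' z) = z"
proof
  have b: "bij_betw f H2 H2" using assms by (simp add: H2_isometry_def)
  let ?f = "inv_into H2 f"
  show 1: "?f (f z) = z" if "z \<in> H2" for z using b that by (simp add: bij_betw_inv_into_left)
  show 2: "f (?f z) = z" if "z \<in> H2" for z using b that by (simp add: bij_betw_inv_into_right)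
  have b': "bij_betw ?f H2 H2" using b by (rule bij_betw_inv_into)
  then have "?f z \<in> H2" if "z \<in> H2" for z using that by (auto simp: bij_betw_def)
  then have "hdist (?f z) (?f w) = hdist z w" if "z \<in> H2" "w \<in> H2" for z w
    using that by (metis 2 H2_isometryD(2)[OF assms])
  with b' show "H2_isometry ?f" by (simp add: H2_isometry_def)
qed

subsection \<open>Moebius transformations\<close>

definition real_moebius :: "real \<Rightarrow> real \<Rightarrow> real \<Rightarrow> real \<Rightarrow> complex \<Rightarrow> complex" where
  "real_moebius a b c d = moebius (of_real a) (of_real b) (of_real c) (of_real d)"

lemma real_moebius_eq:
  "real_moebius a b c d z = (of_real a * z + of_real b) / (of_real c * z + of_real d)"
  by (simp add: real_moebius_def moebius_def)

lemma real_moebius_denom_nonzero: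
  assumes "a * d - b * c = 1" "z \<in> H2"
  shows "of_real c * z + of_real d \<noteq> 0"
proof
  assume "of_real c * z + of_real d = 0"
  then have "c * Re z + d = 0" "c * Im z = 0" by (auto simp: complex_eq_iff)
  then have "c = 0" "d = 0" using assms(2) by (auto simp: H2_def)
  then show False using assms(1) by simp
qed

lemma Im_real_moebius:
  assumes "a * d - b * c = 1" "z \<in> H2"
  shows "Im (real_moebius a b c d z) = Im z / (cmod (of_real c * z + of_real d))\<^sup>2"
proof -
  have "Im (real_moebius a b c d z) = (a * Im z * (c * Re z + d) - (a * Re z + b) * (c * Im z))
      / (cmod (of_real c * z + of_real d))\<^sup>2"
    unfolding cmod_power2 by (simp add: real_moebius_eq Im_divide)
  also have "a * Im z * (c * Re z + d) - (a * Re z + b) * (c * Im z) = (a * d - b * c) * Im z"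
    by (simp add: algebra_simps)
  finally show ?thesis using assms(1) by simp
qed

lemma real_moebius_H2:
  assumes "a * d - b * c = 1" "z \<in> H2"
  shows "real_moebius a b c d z \<in> H2"
  using real_moebius_denom_nonzero[OF assms] assms(2)
  by (simp add: H2_def Im_real_moebius[OF assms])

lemma real_moebius_comp:
  assumes "a' * d' - b' * c' = 1" "a * d - b * c = 1" "z \<in> H2"
  shows "real_moebius a b c d (real_moebius a' b' c' d' z) =
    real_moebius (a * a' + b * c') (a * b' + b * d') (c * a' + d * c') (c * b' + d * d') z"
proof -
  define p where "p = of_real a' * z + of_real b'"
  define r where "r = of_real c' * z + of_real d'"
  have r: "r \<noteq> 0" using real_moebius_denom_nonzero[OF assms(1,3)] by (simp add: r_def)
  have "real_moebius a b c d (p / r) = (of_real a * p + of_real b * r) / (of_real c * p + of_real d * r)"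
  proof -
    have "of_real a * (p / r) + of_real b = (of_real a * p + of_real b * r) / r"
      "of_real c * (p / r) + of_real d = (of_real c * p + of_real d * r) / r"
      using r by (auto simp: field_simps)
    then show ?thesis using r by (simp add: real_moebius_eq)
  qed
  moreover have "real_moebius a' b' c' d' z = p / r" by (simp add: real_moebius_eq p_def r_def)
  ultimately show ?thesis
    by (simp add: real_moebius_eq p_def r_def algebra_simps)
qed

lemma moebius_comp_det:
  fixes a b c d :: real
  assumes "a' * d' - b' * c' = 1" "a * d - b * c = 1"
  shows "(a * a' + b * c') * (c * b' + d * d') - (a * b' + b * d') * (c * a' + d * c') = 1"
proof -
  have "(a * a' + b * c') * (c * b' + d * d') - (a * b' + b * d') * (c * a' + d * c')
    = (a * d - b * c) * (a' * d' - b' * c')" by (simp add: algebra_simps)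
  then show ?thesis using assms by simp
qed

lemma real_moebius_inverse:
  assumes "a * d - b * c = 1" "z \<in> H2"
  shows "real_moebius d (-b) (-c) a (real_moebius a b c d z) = z"
proof -
  have "of_real a * of_real d \<noteq> (of_real b * of_real c :: complex)"
    using assms(1) by (metis diff_self of_real_eq_iff of_real_mult zero_neq_one)
  then show ?thesis
    using real_moebius_denom_nonzero[OF assms]
    by (simp add: real_moebius_def moebius_inverse)
qed

lemma real_moebius_inverse':
  assumes "a * d - b * c = 1" "z \<in> H2"
  shows "real_moebius a b c d (real_moebius d (-b) (-c) a z) = z"
  using real_moebius_inverse[of d a "-b" "-c" z] assms by (simp add: algebra_simps)

text \<open>These two denominators are the ones whose squared moduli divide the imaginary parts, so
  they cancel in |z - w|^2 / (Im z Im w) and the distance is invariant.\<close>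

lemma real_moebius_diff:
  assumes "a * d - b * c = 1" "z \<in> H2" "w \<in> H2"
  shows "real_moebius a b c d z - real_moebius a b c d w =
    (z - w) / ((of_real c * z + of_real d) * (of_real c * w + of_real d))"
proof -
  define u where "u = of_real c * z + of_real d"
  define v where "v = of_real c * w + of_real d"
  have n: "u \<noteq> 0" "v \<noteq> 0"
    using real_moebius_denom_nonzero[OF assms(1)] assms by (auto simp: u_def v_def)
  have 1: "of_real a * of_real d - of_real b * of_real c = (1::complex)"
    using assms(1) by (metis of_real_1 of_real_diff of_real_mult)
  have "(of_real a * z + of_real b) * v - (of_real a * w + of_real b) * u
        = (of_real a * of_real d - of_real b * of_real c) * (z - w)"
    by (simp add: u_def v_def algebra_simps)
  then have "(of_real a * z + of_real b) * v - (of_real a * w + of_real b) * u = z - w"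
    by (simp add: 1)
  then show ?thesis using n
    by (simp add: real_moebius_eq flip: u_def v_def) (simp add: diff_frac_eq)
qed

lemma hdist_real_moebius:
  assumes "a * d - b * c = 1" "z \<in> H2" "w \<in> H2"
  shows "hdist (real_moebius a b c d z) (real_moebius a b c d w) = hdist z w"
proof -
  have n: "of_real c * z + of_real d \<noteq> 0" "of_real c * w + of_real d \<noteq> 0"
    using real_moebius_denom_nonzero[OF assms(1)] assms by auto
  have "x / (p * r)^2 / (2 * (y / p^2) * (y' / r^2)) = x / (2 * y * y')"
    if "p \<noteq> 0" "r \<noteq> 0" for x y y' p r :: real
    using that by (simp add: field_simps)
  then show ?thesis using n
    by (simp add: hdist_def Im_real_moebius assms real_moebius_diff norm_divide norm_mult power_divide)
qed

lemma real_moebius_isometry: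
  assumes "a * d - b * c = 1" shows "H2_isometry (real_moebius a b c d)"
  unfolding H2_isometry_def
proof
  have 1: "d * a - - b * - c = 1" using assms by (simp add: algebra_simps)
  show "bij_betw (real_moebius a b c d) H2 H2"
    by (rule bij_betw_byWitness[where f' = "real_moebius d (-b) (-c) a"])
      (use assms 1 in \<open>auto simp: real_moebius_inverse real_moebius_inverse' real_moebius_H2\<close>)
qed (use hdist_real_moebius[OF assms] in auto)

lemma real_moebius_has_derivative:
  assumes "a * d - b * c = 1" "z \<in> H2"
  shows "(real_moebius a b c d has_field_derivative 1 / (of_real c * z + of_real d)\<^sup>2) (at z)"
proof -
  have n: "of_real c * z + of_real d \<noteq> 0"
    using real_moebius_denom_nonzero[OF assms] by auto
  have 1: "of_real a * of_real d - of_real b * of_real c = (1::complex)"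
    using assms(1) by (metis of_real_1 of_real_diff of_real_mult)
  have "((\<lambda>z. (of_real a * z + of_real b) / (of_real c * z + of_real d)) has_field_derivative
      (of_real a * (of_real c * z + of_real d) - (of_real a * z + of_real b) * of_real c)
        / ((of_real c * z + of_real d) * (of_real c * z + of_real d))) (at z)"
    using n by (auto intro!: derivative_eq_intros)
  moreover have "of_real a * (of_real c * z + of_real d) - (of_real a * z + of_real b) * of_real c = (1::complex)"
    using 1 by (simp add: algebra_simps)
  ultimately show ?thesis by (simp add: real_moebius_def moebius_def power2_eq_square)
qed

subsection \<open>The imaginary axis\<close>

text \<open>The exponential is arc length: this is the model geodesic line of unit speed, and
  translation by r along it is multiplication by exp r.\<close>

definition im_axis :: "real \<Rightarrow> complex" where
  "im_axis s = Complex 0 (exp s)"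

lemma im_axis_H2 [simp]: "im_axis s \<in> H2"
  by (simp add: im_axis_def H2_def)

lemma im_axis_sel [simp]: "Re (im_axis s) = 0" "Im (im_axis s) = exp s" "cmod (im_axis s) = exp s"
  by (auto simp: im_axis_def cmod_def)

lemma cosh_hdist_axis:
  assumes "z \<in> H2"
  shows "cosh (hdist z (im_axis s)) = ((cmod z)\<^sup>2 * exp (- s) + exp s) / (2 * Im z)"
  using H2_Im_pos[OF assms]
  by (simp add: cosh_hdist assms exp_minus field_simps power2_eq_square)

lemma hdist_axis: "hdist (im_axis s) (im_axis t) = \<bar>s - t\<bar>"
proof (rule hdist_eqI)
  have "cosh (hdist (im_axis s) (im_axis t)) = (exp (s - t) + exp (t - s)) / 2"
    by (simp add: cosh_hdist_axis exp_diff exp_minus field_simps power2_eq_square)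
  then show "cosh (hdist (im_axis s) (im_axis t)) = cosh \<bar>s - t\<bar>"
    by (simp add: cosh_field_def abs_if)
qed auto

text \<open>The cosh of the distance to \<open>im_axis s\<close> is a combination of exp (-s) and
  exp s with coefficients |z|^2 / (2 Im z) and 1 / (2 Im z), so two values of s determine both
  coefficients. The offset \<open>r\<close> serves translations along the axis. \<open>A\<close> and
  \<open>B\<close> are twice the differences of the coefficients of z and of w moved back by
  \<open>r\<close>.\<close>

lemma hdist_axis_determines:
  assumes z: "z \<in> H2" "w \<in> H2" and st: "s \<noteq> t"
    and eq: "hdist z (im_axis s) = hdist w (im_axis (s + r))" "hdist z (im_axis t) = hdist w (im_axis (t + r))"
  shows "cmod w = exp r * cmod z" "Im w = exp r * Im z"
proof -
  have p: "Im z > 0" "Im w > 0" using z by (auto simp: H2_def)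
  define A where "A = (cmod z)\<^sup>2 / Im z - (cmod w)\<^sup>2 * exp (-r) / Im w"
  define B where "B = 1 / Im z - exp r / Im w"
  have 1: "A * exp (-x) + B * exp x = 0" if "hdist z (im_axis x) = hdist w (im_axis (x + r))" for x
  proof -
    define X where "X = exp (- x)"
    define E where "E = exp x"
    define R where "R = exp r"
    define R' where "R' = exp (- r)"
    have e: "exp (- (x + r)) = X * R'" "exp (x + r) = E * R"
      by (simp_all add: X_def E_def R_def R'_def flip: exp_add)
    have "((cmod z)\<^sup>2 * X + E) / (2 * Im z) = ((cmod w)\<^sup>2 * (X * R') + E * R) / (2 * Im w)"
      using arg_cong[OF that, of cosh] unfolding cosh_hdist_axis[OF z(1)] cosh_hdist_axis[OF z(2)] e
      by (simp add: X_def E_def)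
    moreover have "A * X + B * E = 2 * (((cmod z)\<^sup>2 * X + E) / (2 * Im z)) - 2 * (((cmod w)\<^sup>2 * (X * R') + E * R) / (2 * Im w))"
      by (simp add: A_def B_def R_def R'_def algebra_simps add_divide_distrib)
    ultimately show ?thesis by (simp add: X_def E_def)
  qed
  \<comment> \<open>Multiplying by exp x leaves a single exponential, so two distinct zeros force B
    = 0 and then A = 0.\<close>
  have "A + B * exp (2 * x) = exp x * (A * exp (-x) + B * exp x)" for x
    by (simp add: algebra_simps exp_minus flip: mult_exp_exp) (simp add: mult_exp_exp)
  then have 2: "A + B * exp (2 * x) = 0" if "hdist z (im_axis x) = hdist w (im_axis (x + r))" for x
    using 1[OF that] by simp
  have "B * (exp (2 * s) - exp (2 * t)) = 0"
  proof -
    have "B * (exp (2 * s) - exp (2 * t)) = (A + B * exp (2 * s)) - (A + B * exp (2 * t))"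
      by (simp add: algebra_simps)
    then show ?thesis using 2[OF eq(1)] 2[OF eq(2)] by simp
  qed
  then have B: "B = 0" using st by simp
  then have A: "A = 0" using 2[OF eq(1)] by simp
  from B p show I: "Im w = exp r * Im z" by (simp add: B_def field_simps)
  from A p have "(cmod w)\<^sup>2 * exp (-r) * Im z = (cmod z)\<^sup>2 * Im w" by (simp add: A_def field_simps)
  then have "(cmod w)\<^sup>2 = (exp r)\<^sup>2 * (cmod z)\<^sup>2" using p
    by (simp add: I exp_minus field_simps power2_eq_square)
  then show "cmod w = exp r * cmod z"
    by (metis exp_ge_zero norm_ge_zero power2_eq_iff_nonneg power_mult_distrib split_mult_pos_le)
qed

text \<open>The distances of \<open>\<sigma> t\<close> to the points at times 0 and 1 give |z| = Im
  z = exp t, which leaves no room for a real part.\<close>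

lemma geodesic_line_through_axis:
  assumes "geodesic_line \<sigma>" "\<sigma> 0 = im_axis 0" "\<sigma> 1 = im_axis 1"
  shows "\<sigma> t = im_axis t"
proof -
  have H: "\<sigma> t \<in> H2" for t using assms(1) by (auto simp: geodesic_line_def)
  have d: "hdist (\<sigma> s) (\<sigma> t) = \<bar>s - t\<bar>" for s t using assms(1) by (auto simp: geodesic_line_def)
  have e: "hdist (im_axis t) (im_axis 0) = hdist (\<sigma> t) (im_axis (0 + 0))"
    "hdist (im_axis t) (im_axis 1) = hdist (\<sigma> t) (im_axis (1 + 0))"
    using d[of t 0] d[of t 1] assms(2,3) by (simp_all add: hdist_axis)
  from hdist_axis_determines[OF im_axis_H2 H _ e]
  have *: "cmod (\<sigma> t) = exp t" "Im (\<sigma> t) = exp t" by auto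
  then have "Re (\<sigma> t) = 0" using cmod_power2[of "\<sigma> t"] by simp
  with * show ?thesis by (simp add: complex_eq_iff)
qed

text \<open>An affine map takes z to \<i>, a rotation about \<i> then brings the image of w onto the
  axis, and a half turn about \<i> corrects the direction if w arrives below \<i>.\<close>

lemma moebius_to_axis:
  assumes "z \<in> H2" "w \<in> H2" "hdist z w = 1"
  obtains a b c d where "a * d - b * c = 1" "real_moebius a b c d z = im_axis 0" "real_moebius a b c d w = im_axis 1"
proof -
  define y where "y = sqrt (Im z)"
  have y: "y > 0" "Im z = y * y" using H2_Im_pos[OF assms(1)] by (auto simp: y_def)
  have d1: "1 / y * y - (- Re z / y) * 0 = 1" using y by simp
  define v where "v = real_moebius (1/y) (- Re z / y) 0 y w"
  have z1: "real_moebius (1/y) (- Re z / y) 0 y z = im_axis 0"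
    using y by (simp add: real_moebius_eq complex_eq_iff Re_divide Im_divide field_simps power2_eq_square)
  have v: "v \<in> H2" unfolding v_def by (rule real_moebius_H2[OF d1 assms(2)])
  \<comment> \<open>Up to a positive factor, \<open>A t\<close> is the real part of the image of v
    under the rotation with parameter t. It takes opposite values at 0 and pi / 2, so it vanishes in
    between.\<close>
  define A where "A = (\<lambda>t. (cos t * cos t - sin t * sin t) * Re v + sin t * cos t * (1 - (cmod v)\<^sup>2))"
  have "\<exists>t\<ge>0. t \<le> pi / 2 \<and> A t = 0"
  proof (cases "Re v \<le> 0")
    case True
    then show ?thesis by (intro IVT) (auto simp: A_def intro!: continuous_intros)
  next
    case False
    then show ?thesis by (intro IVT2) (auto simp: A_def intro!: continuous_intros)
  qed
  then obtain t where t: "A t = 0" by blast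
  have d2: "cos t * cos t - sin t * (- sin t) = 1"
    using sin_cos_squared_add[of t] by (simp add: power2_eq_square)
  define R where "R = real_moebius (cos t) (sin t) (- sin t) (cos t)"
  have Ri: "R (im_axis 0) = im_axis 0"
    using d2 by (simp add: R_def real_moebius_eq im_axis_def complex_eq_iff Re_divide Im_divide power2_eq_square)
  have "Re ((cos t * v + sin t) * cnj (- sin t * v + cos t)) = A t"
    unfolding A_def cmod_power2 by (simp add: power2_eq_square algebra_simps)
  then have "Re (R v) = 0"
    using t by (simp add: R_def real_moebius_eq complex_div_cnj[of "cos t * v + sin t"] )
  have RH: "R v \<in> H2" unfolding R_def by (rule real_moebius_H2[OF d2 v])
  have "hdist (im_axis 0) (R v) = 1"
    using hdist_real_moebius[OF d2 im_axis_H2 v, of 0] hdist_real_moebius[OF d1 assms(1,2)] Ri z1 assms(3)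
    by (simp add: R_def v_def)
  define x where "x = ln (Im (R v))"
  have Rv: "R v = im_axis x" using \<open>Re (R v) = 0\<close> H2_Im_pos[OF RH] by (simp add: complex_eq_iff x_def)
  then have "\<bar>x\<bar> = 1" using \<open>hdist (im_axis 0) (R v) = 1\<close> by (simp add: hdist_axis)
  then consider "x = 1" | "x = -1" by linarith
  then show thesis
  proof cases
    case 1
    have "real_moebius (cos t) (sin t) (- sin t) (cos t) (real_moebius (1/y) (- Re z / y) 0 y z) = im_axis 0"
      "real_moebius (cos t) (sin t) (- sin t) (cos t) (real_moebius (1/y) (- Re z / y) 0 y w) = im_axis 1"
      using z1 Ri Rv 1 by (auto simp: R_def v_def)
    then show thesis
      unfolding real_moebius_comp[OF d1 d2 assms(1)] real_moebius_comp[OF d1 d2 assms(2)]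
      by (rule that[OF moebius_comp_det[OF d1 d2]])
  next
    \<comment> \<open>The image of w is \<open>im_axis (-1)\<close>; the map z -> -1/z fixes \<i>
      and reverses the axis.\<close>
    case 2
    have d3: "(0::real) * 0 - (1::real) * (-1) = 1" by simp
    have s: "real_moebius 0 1 (-1) 0 (im_axis r) = im_axis (-r)" for r
      by (simp add: real_moebius_eq im_axis_def complex_eq_iff Re_divide Im_divide exp_minus power2_eq_square field_simps)
    note d4 = moebius_comp_det[OF d2 d3]
    have "real_moebius 0 1 (-1) 0 (real_moebius (cos t) (sin t) (- sin t) (cos t) (real_moebius (1/y) (- Re z / y) 0 y z)) = im_axis 0"
      "real_moebius 0 1 (-1) 0 (real_moebius (cos t) (sin t) (- sin t) (cos t) (real_moebius (1/y) (- Re z / y) 0 y w)) = im_axis 1"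
      using z1 Ri Rv 2 by (auto simp: R_def v_def s)
    then show thesis
      unfolding real_moebius_comp[OF d2 d3 real_moebius_H2[OF d1 assms(1)]] real_moebius_comp[OF d2 d3 real_moebius_H2[OF d1 assms(2)]]
        real_moebius_comp[OF d1 d4 assms(1)] real_moebius_comp[OF d1 d4 assms(2)]
      by (rule that[OF moebius_comp_det[OF d1 d4]])
  qed
qed

text \<open>A geodesic line is given by distances only; this supplies a formula for it, and with it
  a derivative, on which the notion of perpendicular foot depends.\<close>

lemma geodesic_line_moebius:
  assumes "geodesic_line \<sigma>"
  obtains a b c d where "a * d - b * c = 1" "\<And>t. \<sigma> t = real_moebius a b c d (im_axis t)"
proof -
  have H: "\<sigma> t \<in> H2" for t using assms by (auto simp: geodesic_line_def)
  have d: "hdist (\<sigma> s) (\<sigma> t) = \<bar>s - t\<bar>" for s t using assms by (auto simp: geodesic_line_def)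
  obtain a b c d' where e: "a * d' - b * c = 1" and ax: "real_moebius a b c d' (\<sigma> 0) = im_axis 0" "real_moebius a b c d' (\<sigma> 1) = im_axis 1"
    using moebius_to_axis[of "\<sigma> 0" "\<sigma> 1"] H d[of 0 1] by (metis abs_1 abs_minus_commute diff_zero)
  have "geodesic_line (real_moebius a b c d' \<circ> \<sigma>)"
    unfolding geodesic_line_def using real_moebius_H2[OF e H] hdist_real_moebius[OF e H H] d by auto
  then have "real_moebius a b c d' (\<sigma> t) = im_axis t" for t
    using geodesic_line_through_axis[of "real_moebius a b c d' \<circ> \<sigma>" t] ax by auto
  then have "\<sigma> t = real_moebius d' (-b) (-c) a (im_axis t)" for t
    using real_moebius_inverse[OF e H, of t] by simp
  then show thesis
    by (intro that[of d' a "-b" "-c"]) (use e in \<open>auto simp: algebra_simps\<close>)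
qed

lemma vector_derivative_moebius_axis:
  assumes "a * d - b * c = 1"
  shows "((\<lambda>t. real_moebius a b c d (im_axis t)) has_vector_derivative
     im_axis t / (of_real c * im_axis t + of_real d)\<^sup>2) (at t)"
proof -
  have "(im_axis has_vector_derivative im_axis t) (at t)"
  proof -
    have "im_axis = (\<lambda>t. of_real (exp t) * \<i>)" by (auto simp: im_axis_def complex_eq_iff)
    moreover have "((\<lambda>t. of_real (exp t) * \<i>) has_vector_derivative of_real (exp t) * \<i>) (at t)"
      by (intro has_vector_derivative_mult_left has_vector_derivative_of_real)
        (simp flip: has_real_derivative_iff_has_vector_derivative)
    ultimately show ?thesis by metis
  qed
  from field_vector_diff_chain_at[OF this real_moebius_has_derivative[OF assms im_axis_H2]]
  show ?thesis by (simp add: o_def)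
qed

text \<open>Transported back to the imaginary axis, the perpendicular at \<open>im_axis s\<close> is
  the half circle |z| = exp s.\<close>

lemma perpendicular_foot_axis:
  assumes M: "a * d - b * c = 1" and \<sigma>: "\<And>t. \<sigma> t = real_moebius a b c d (im_axis t)"
    and pf: "perpendicular_foot \<sigma> (real_moebius a b c d z) s" and z: "z \<in> H2"
  shows "cmod z = exp s"
proof -
  obtain \<rho> u where \<rho>: "geodesic_line \<rho>" "\<rho> 0 = \<sigma> s" "\<rho> u = real_moebius a b c d z"
    and orth: "vector_derivative \<rho> (at 0) \<bullet> vector_derivative \<sigma> (at s) = 0"
    using pf unfolding perpendicular_foot_def by (elim exE conjE)
  obtain a1 b1 c1 d1 where M1: "a1 * d1 - b1 * c1 = 1" and \<rho>m: "\<And>t. \<rho> t = real_moebius a1 b1 c1 d1 (im_axis t)"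
    by (rule geodesic_line_moebius[OF \<rho>(1)], rule that)
  have M': "d * a - (-b) * (-c) = 1" using M by (simp add: algebra_simps)
  \<comment> \<open>The matrix of \<open>\<rho>\<close> as seen after moving \<open>\<sigma>\<close>
    back to the axis: the inverse of the matrix of \<open>\<sigma>\<close> times that of
    \<open>\<rho>\<close>.\<close>
  define a2 where "a2 = d * a1 + - b * c1"
  define b2 where "b2 = d * b1 + - b * d1"
  define c2 where "c2 = - c * a1 + a * c1"
  define d2 where "d2 = - c * b1 + a * d1"
  have M2: "a2 * d2 - b2 * c2 = 1"
    unfolding a2_def b2_def c2_def d2_def by (rule moebius_comp_det[OF M1 M'])
  have comp: "real_moebius d (-b) (-c) a (\<rho> t) = real_moebius a2 b2 c2 d2 (im_axis t)" for t
    unfolding \<rho>m a2_def b2_def c2_def d2_def by (rule real_moebius_comp[OF M1 M' im_axis_H2])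
  have 0: "real_moebius a2 b2 c2 d2 (im_axis 0) = im_axis s"
    using comp[of 0] \<rho>(2) real_moebius_inverse[OF M im_axis_H2] by (simp add: \<sigma>)
  have u: "real_moebius a2 b2 c2 d2 (im_axis u) = z"
    using comp[of u] \<rho>(3) real_moebius_inverse[OF M z] by simp
  have n2: "of_real c2 * im_axis 0 + of_real d2 \<noteq> 0" by (rule real_moebius_denom_nonzero[OF M2 im_axis_H2])
  have eq: "of_real a2 * im_axis 0 + of_real b2 = im_axis s * (of_real c2 * im_axis 0 + of_real d2)"
    using 0 n2 by (simp add: real_moebius_eq field_simps)
  have ab: "a2 = exp s * d2" "b2 = - exp s * c2"
    using arg_cong[OF eq, of Im] arg_cong[OF eq, of Re] by auto
  define D where "D = 1 / (of_real c * im_axis s + of_real d)\<^sup>2"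
  have "of_real c * im_axis s + of_real d \<noteq> 0" by (rule real_moebius_denom_nonzero[OF M im_axis_H2])
  then have D: "D \<noteq> 0" by (simp add: D_def)
  have v1: "vector_derivative \<sigma> (at s) = D * im_axis s"
    unfolding \<sigma>[abs_def] D_def using vector_derivative_at[OF vector_derivative_moebius_axis[OF M]] by simp
  have "\<rho> t = real_moebius a b c d (real_moebius a2 b2 c2 d2 (im_axis t))" for t
  proof -
    have "\<rho> t \<in> H2" using \<rho>(1) by (auto simp: geodesic_line_def)
    from real_moebius_inverse'[OF M this] show ?thesis by (simp add: comp)
  qed
  moreover have "((\<lambda>t. real_moebius a b c d (real_moebius a2 b2 c2 d2 (im_axis t))) has_vector_derivative
      im_axis 0 / (of_real c2 * im_axis 0 + of_real d2)\<^sup>2 * D) (at 0)"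
    using field_vector_diff_chain_at[OF vector_derivative_moebius_axis[OF M2, of 0]
        real_moebius_has_derivative[OF M real_moebius_H2[OF M2 im_axis_H2]]] 0
    by (simp add: o_def D_def)
  ultimately have v2: "vector_derivative \<rho> (at 0) = im_axis 0 / (of_real c2 * im_axis 0 + of_real d2)\<^sup>2 * D"
    using vector_derivative_at by (metis (no_types, lifting) ext)
  define E where "E = of_real c2 * im_axis 0 + of_real d2"
  have "(D * p) \<bullet> (D * r) = (cmod D)\<^sup>2 * (p \<bullet> r)" for p r
    unfolding inner_complex_def cmod_power2 by (simp add: power2_eq_square algebra_simps)
  note inner_scale = this
  \<comment> \<open>Multiplication by \<open>D\<close> is a rotation and scaling, so it drops out of
    the orthogonality. What remains says that im_axis 0 / E^2 is horizontal, that is c2^2 =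
    d2^2.\<close>
  have "(D * (im_axis 0 / E\<^sup>2)) \<bullet> (D * im_axis s) = 0"
    using orth unfolding v1 v2 E_def by (simp add: mult.commute)
  then have "(im_axis 0 / E\<^sup>2) \<bullet> im_axis s = 0"
    unfolding inner_scale using D by simp
  then have "Im (im_axis 0 / E\<^sup>2) = 0" by (simp add: inner_complex_def)
  then have "Re (E\<^sup>2) = 0"
    using n2 by (auto simp: Im_divide E_def)
  then have cd: "c2\<^sup>2 = d2\<^sup>2" by (simp add: E_def power2_eq_square)
  have nu: "of_real c2 * im_axis u + of_real d2 \<noteq> 0" by (rule real_moebius_denom_nonzero[OF M2 im_axis_H2])
  have "(cmod z)\<^sup>2 * (cmod (of_real c2 * im_axis u + of_real d2))\<^sup>2 = (cmod (of_real a2 * im_axis u + of_real b2))\<^sup>2"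
  proof -
    have "of_real a2 * im_axis u + of_real b2 = z * (of_real c2 * im_axis u + of_real d2)"
      using u nu by (auto simp: real_moebius_eq)
    then show ?thesis by (simp add: norm_mult power_mult_distrib)
  qed
  also have "\<dots> = (exp s)\<^sup>2 * (d2\<^sup>2 * (exp u)\<^sup>2 + c2\<^sup>2)"
    by (simp add: cmod_power2 ab power_mult_distrib algebra_simps)
  also have "\<dots> = (exp s)\<^sup>2 * (cmod (of_real c2 * im_axis u + of_real d2))\<^sup>2"
    using cd by (simp add: cmod_power2 power_mult_distrib algebra_simps)
  finally have "(cmod z)\<^sup>2 = (exp s)\<^sup>2" using nu by simp
  then show ?thesis by simp
qed

subsection \<open>Geodesic segments\<close>

definition cone :: "real \<Rightarrow> complex set" where
  "cone k = {z \<in> H2. \<bar>Re z\<bar> \<le> k * Im z}"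

text \<open>For the interpolation coefficients of a geodesic segment this says that their sum is at
  most 1, which keeps the segment inside the cone.\<close>

lemma sinh_add_le:
  fixes x y :: real
  assumes "0 \<le> x" "0 \<le> y"
  shows "sinh x + sinh y \<le> sinh (x + y)"
proof -
  have "sinh x * 1 + 1 * sinh y \<le> sinh x * cosh y + cosh x * sinh y"
    using assms by (intro add_mono mult_mono) (auto simp: cosh_real_ge_1)
  then show ?thesis by (simp add: sinh_add)
qed

text \<open>After division by (sinh L)^2 this is the Lorentz product of two points of a geodesic of
  length L, at distances x and y from its start.\<close>

lemma sinh_comb:
  fixes x y L :: real
  shows "sinh (L - x) * sinh (L - y) + sinh x * sinh y
    + (sinh (L - x) * sinh y + sinh x * sinh (L - y)) * cosh L = (sinh L)\<^sup>2 * cosh (x - y)"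
proof -
  have "sinh (L - x) * sinh (L - y) + sinh x * sinh y
      + (sinh (L - x) * sinh y + sinh x * sinh (L - y)) * cosh L
    = (sinh L)\<^sup>2 * (cosh x * cosh y) + sinh x * sinh y * (1 - (cosh L)\<^sup>2)"
    unfolding sinh_diff by (simp add: algebra_simps power2_eq_square)
  also have "\<dots> = (sinh L)\<^sup>2 * cosh (x - y)"
    unfolding cosh_square_eq cosh_diff by (simp add: algebra_simps)
  finally show ?thesis .
qed

text \<open>In the coordinates \<open>(Re z / Im z, 1 / Im z, |z|\<^sup>2 / Im z)\<close> of the hyperboloid model geodesics are
  the combinations of the endpoints with coefficients \<open>sinh (L - t) / sinh L\<close> and \<open>sinh t / sinh L\<close>.\<close>

lemma geodesic_segment:
  assumes z: "z \<in> H2" "w \<in> H2"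
  obtains \<sigma> where "\<sigma> 0 = z" "\<sigma> 1 = w" "\<And>s. s \<in> {0..1} \<Longrightarrow> \<sigma> s \<in> H2"
    "\<And>s t. s \<in> {0..1} \<Longrightarrow> t \<in> {0..1} \<Longrightarrow> hdist (\<sigma> s) (\<sigma> t) = hdist z w * \<bar>s - t\<bar>"
    "\<And>k s. z \<in> cone k \<Longrightarrow> w \<in> cone k \<Longrightarrow> s \<in> {0..1} \<Longrightarrow> \<sigma> s \<in> cone k"
proof (cases "z = w")
  case True
  show thesis by (rule that[of "\<lambda>_. z"]) (use True z in auto)
next
  case False
  define L where "L = hdist z w"
  have p: "Im z > 0" "Im w > 0" using z by (auto simp: H2_def)
  have "L \<noteq> 0" using norm_diff_hdist[OF z] False by (auto simp: L_def)
  then have L: "L > 0" using hdist_nonneg[OF z] by (simp add: L_def)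
  define S where "S = sinh L"
  have S: "S > 0" using L by (simp add: S_def)
  define u where "u = (\<lambda>t. sinh (L - L * t) / S)"
  define v where "v = (\<lambda>t. sinh (L * t) / S)"
  define P where "P = (\<lambda>t. u t / Im z + v t / Im w)"
  define R where "R = (\<lambda>t. u t * Re z / Im z + v t * Re w / Im w)"
  define Q where "Q = (\<lambda>t. u t * (cmod z)\<^sup>2 / Im z + v t * (cmod w)\<^sup>2 / Im w)"
  define \<sigma> where "\<sigma> = (\<lambda>t. Complex (R t / P t) (1 / P t))"
  have uv: "u t \<ge> 0" "v t \<ge> 0" "u t + v t > 0" "u t + v t \<le> 1" if "t \<in> {0..1}" for t
  proof -
    have b: "0 \<le> L * t" "0 \<le> L - L * t" using that L by (auto simp: mult_left_le)
    then show "u t \<ge> 0" "v t \<ge> 0" using S by (auto simp: u_def v_def)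
    show "u t + v t \<le> 1" using sinh_add_le[OF b(2,1)] S by (simp add: u_def v_def S_def field_simps)
    have "sinh (L - L * t) + sinh (L * t) > 0"
    proof (cases "t = 0")
      case True then show ?thesis using L by simp
    next
      case False
      then have "sinh (L * t) > 0" using L that by auto
      then show ?thesis using b by (simp add: add_nonneg_pos)
    qed
    then show "u t + v t > 0" using S by (simp add: u_def v_def flip: add_divide_distrib)
  qed
  have P: "P t > 0" if "t \<in> {0..1}" for t
  proof (cases "u t = 0")
    case True
    then show ?thesis using uv[OF that] p by (simp add: P_def)
  next
    case False
    then have "u t / Im z > 0" using uv(1)[OF that] p by simp
    then show ?thesis using uv(2)[OF that] p by (simp add: P_def add_pos_nonneg)
  qed
  have H: "\<sigma> t \<in> H2" if "t \<in> {0..1}" for t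
    using P[OF that] by (simp add: \<sigma>_def H2_def)
  have cz: "(cmod z)\<^sup>2 = (Re z)\<^sup>2 + (Im z)\<^sup>2" "(cmod w)\<^sup>2 = (Re w)\<^sup>2 + (Im w)\<^sup>2"
    by (simp_all add: cmod_power2)
  have cL: "cosh L = ((cmod z)\<^sup>2 + (cmod w)\<^sup>2 - 2 * Re z * Re w) / (2 * Im z * Im w)"
    unfolding L_def by (rule cosh_hdist[OF z])
  \<comment> \<open>The left side is the Lorentz form; on the coordinates of two points of
    \<open>H2\<close> it is the cosh of their distance. With s = t it shows that the interpolated
    point lies on the hyperboloid.\<close>
  have form: "(P s * Q t + Q s * P t) / 2 - R s * R t = cosh (L * s - L * t)" for s t
  proof -
    have 1: "(P s * Q t + Q s * P t) / 2 - R s * R t =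
      u s * u t + v s * v t + (u s * v t + v s * u t) * cosh L"
      using p unfolding P_def Q_def R_def cL cz by (simp add: field_simps power2_eq_square)
    have "S\<^sup>2 * (u s * u t + v s * v t + (u s * v t + v s * u t) * cosh L) = S\<^sup>2 * cosh (L * s - L * t)"
    proof -
      have uv: "sinh (L - L * t) = S * u t" "sinh (L * t) = S * v t" for t using S by (simp_all add: u_def v_def)
      show ?thesis
        using sinh_comb[of L "L * s" "L * t"] unfolding uv S_def[symmetric]
        by (simp add: algebra_simps power2_eq_square)
    qed
    then show ?thesis using 1 S by simp
  qed
  have PQ: "P t * Q t = (R t)\<^sup>2 + 1" for t
    using form[of t t] by (simp add: power2_eq_square)
  have d: "hdist (\<sigma> s) (\<sigma> t) = L * \<bar>s - t\<bar>" if "s \<in> {0..1}" "t \<in> {0..1}" for s t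
  proof (rule hdist_eqI[OF H[OF that(1)] H[OF that(2)]])
    have Ps: "P s > 0" "P t > 0" using P that by auto
    have c: "(cmod (\<sigma> x))\<^sup>2 = Q x / P x" if "x \<in> {0..1}" for x
    proof -
      have "(cmod (\<sigma> x))\<^sup>2 = ((R x)\<^sup>2 + 1) / (P x)\<^sup>2"
        by (simp add: \<sigma>_def cmod_power2 power_divide add_divide_distrib)
      also have "\<dots> = Q x / P x" unfolding PQ[symmetric] using P[OF that] by (simp add: power2_eq_square)
      finally show ?thesis .
    qed
    have "cosh (hdist (\<sigma> s) (\<sigma> t)) = (Q s / P s + Q t / P t - 2 * (R s / P s) * (R t / P t)) / (2 * (1 / P s) * (1 / P t))"
      unfolding cosh_hdist[OF H[OF that(1)] H[OF that(2)]] c[OF that(1)] c[OF that(2)] by (simp add: \<sigma>_def)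
    also have "\<dots> = (P s * Q t + Q s * P t) / 2 - R s * R t"
      using Ps by (simp add: field_simps)
    also have "\<dots> = cosh \<bar>L * s - L * t\<bar>" using form by simp
    also have "\<bar>L * s - L * t\<bar> = L * \<bar>s - t\<bar>" using L by (simp add: abs_mult flip: right_diff_distrib)
    finally show "cosh (hdist (\<sigma> s) (\<sigma> t)) = cosh (L * \<bar>s - t\<bar>)" .
  qed (use L in auto)
  \<comment> \<open>The quotient Re / Im is the linear coordinate \<open>R\<close>, so membership in
    the cone is a bound on a combination whose nonnegative coefficients sum to at most 1.\<close>
  have c: "\<sigma> s \<in> cone k" if "z \<in> cone k" "w \<in> cone k" "s \<in> {0..1}" for k s
  proof -
    have k: "\<bar>Re z / Im z\<bar> \<le> k" "\<bar>Re w / Im w\<bar> \<le> k"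
      using that p by (auto simp: cone_def abs_divide field_simps)
    then have k0: "k \<ge> 0" by linarith
    have "\<bar>R s\<bar> \<le> \<bar>u s * (Re z / Im z)\<bar> + \<bar>v s * (Re w / Im w)\<bar>" unfolding R_def by (metis abs_triangle_ineq times_divide_eq_right)
    also have "\<dots> \<le> u s * k + v s * k"
      unfolding abs_mult using uv[OF that(3)] k by (intro add_mono mult_mono) auto
    also have "\<dots> \<le> 1 * k"
      unfolding distrib_right[symmetric] using uv(4)[OF that(3)] k0 by (rule mult_right_mono)
    finally show ?thesis
      using H[OF that(3)] P[OF that(3)] by (simp add: cone_def \<sigma>_def abs_divide field_simps)
  qed
  have "\<sigma> 0 = z" "\<sigma> 1 = w"
    using p S by (auto simp: \<sigma>_def R_def P_def u_def v_def complex_eq_iff simp flip: S_def)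
  then show thesis using that[of \<sigma>] H d c by (simp add: L_def)
qed

lemma convex_H2: "convex H2"
proof -
  have "H2 = {z. \<i> \<bullet> z > 0}" by (auto simp: H2_def inner_complex_def)
  then show ?thesis by (metis convex_halfspace_gt)
qed

lemma convex_cone: "convex (cone k)"
proof -
  have "cone k = H2 \<inter> {z. Complex 1 (- k) \<bullet> z \<le> 0} \<inter> {z. Complex (-1) (- k) \<bullet> z \<le> 0}"
    by (auto simp: cone_def inner_complex_def)
  then show ?thesis
    by (simp only: convex_Int convex_H2 convex_halfspace_le)
qed

text \<open>The cone is the neighbourhood of the imaginary axis of radius \<open>arsinh k\<close>.\<close>

lemma cone_iff:
  assumes "z \<in> H2" "k \<ge> 0"
  shows "z \<in> cone k \<longleftrightarrow> (\<exists>s. hdist z (im_axis s) \<le> arsinh k)"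
proof -
  have p: "Im z > 0" using assms by (simp add: H2_def)
  then have m: "cmod z > 0" by auto
  have ck: "cosh (arsinh k) = sqrt (1 + k\<^sup>2)" by (simp add: cosh_arsinh_real add.commute)
  have sq: "1 + (Re z / Im z)\<^sup>2 = (cmod z / Im z)\<^sup>2"
    using p by (simp add: power_divide cmod_power2 field_simps)
  \<comment> \<open>The quotient |z| / Im z is the cosh of the distance from z to the axis; it is
    attained at the foot s = ln |z|.\<close>
  have le: "cmod z / Im z \<le> sqrt (1 + k\<^sup>2) \<longleftrightarrow> z \<in> cone k"
  proof -
    have "cmod z / Im z \<le> sqrt (1 + k\<^sup>2) \<longleftrightarrow> (cmod z / Im z)\<^sup>2 \<le> 1 + k\<^sup>2"
      using p by (simp flip: real_sqrt_le_iff[of "(cmod z / Im z)\<^sup>2"] add: abs_divide)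
    also have "\<dots> \<longleftrightarrow> (Re z / Im z)\<^sup>2 \<le> k\<^sup>2" by (simp flip: sq)
    also have "\<dots> \<longleftrightarrow> \<bar>Re z / Im z\<bar> \<le> \<bar>k\<bar>" by (rule abs_le_square_iff[symmetric])
    also have "\<dots> \<longleftrightarrow> z \<in> cone k" using p assms by (simp add: cone_def abs_divide field_simps)
    finally show ?thesis .
  qed
  have ark: "arsinh k \<ge> 0"
    using assms(2) sinh_real_nonneg_iff[of "arsinh k"] by simp
  show ?thesis
  proof
    assume "z \<in> cone k"
    then have "cosh (hdist z (im_axis (ln (cmod z)))) \<le> cosh (arsinh k)"
      using le m p by (simp add: cosh_hdist_axis[OF assms(1)] ck exp_minus power2_eq_square field_simps)
    then have "hdist z (im_axis (ln (cmod z))) \<le> arsinh k"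
      using ark hdist_nonneg[OF assms(1) im_axis_H2] by (simp add: cosh_real_nonneg_le_iff)
    then show "\<exists>s. hdist z (im_axis s) \<le> arsinh k" ..
  next
    assume "\<exists>s. hdist z (im_axis s) \<le> arsinh k"
    then obtain s where "hdist z (im_axis s) \<le> arsinh k" ..
    then have "cosh (hdist z (im_axis s)) \<le> cosh (arsinh k)"
      using ark hdist_nonneg[OF assms(1) im_axis_H2] by (simp add: cosh_real_nonneg_le_iff)
    moreover have "cmod z / Im z \<le> cosh (hdist z (im_axis s))"
    proof -
      have "0 \<le> (cmod z - exp s)\<^sup>2" by simp
      then have "2 * cmod z * exp s \<le> (cmod z)\<^sup>2 + (exp s)\<^sup>2" by (simp add: power2_diff)
      then have "2 * cmod z \<le> (cmod z)\<^sup>2 * exp (-s) + exp s"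
        by (simp add: exp_minus field_simps power2_eq_square)
      then show ?thesis using p by (simp add: cosh_hdist_axis[OF assms(1)] field_simps)
    qed
    ultimately show "z \<in> cone k" using le ck by simp
  qed
qed

text \<open>On both boundary rays |z| is sqrt (1 + k^2) times Im z, which makes the heights
  explicit. The sign \<open>e\<close> records which ray carries z; since the rays are opposite, the
  product of the real parts is negative and k^2 is added.\<close>

lemma hdist_across_cone:
  assumes "z \<in> H2" "w \<in> H2" "Re z = e * k * Im z" "Re w = - e * k * Im w" "e * e = 1"
    and "cmod z = exp s" "cmod w = exp t"
  shows "cosh (hdist z w) = (1 + k\<^sup>2) * cosh (s - t) + k\<^sup>2"
proof -
  define r where "r = sqrt (1 + k\<^sup>2)"
  have r: "r > 0" "r\<^sup>2 = 1 + k\<^sup>2" by (auto simp: r_def add_pos_nonneg)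
  have Iz: "Im z = exp s / r"
  proof -
    have "(exp s)\<^sup>2 = (r * Im z)\<^sup>2" unfolding assms(6)[symmetric]
      using assms(5) by (simp add: cmod_power2 assms(3) power_mult_distrib r(2)) (simp add: algebra_simps power2_eq_square)
    then have "exp s = r * Im z"
      using r(1) H2_Im_pos[OF assms(1)] by (subst (asm) power2_eq_iff_nonneg) auto
    then show ?thesis using r(1) by simp
  qed
  have Iw: "Im w = exp t / r"
  proof -
    have "(exp t)\<^sup>2 = (r * Im w)\<^sup>2" unfolding assms(7)[symmetric]
      using assms(5) by (simp add: cmod_power2 assms(4) power_mult_distrib r(2)) (simp add: algebra_simps power2_eq_square)
    then have "exp t = r * Im w"
      using r(1) H2_Im_pos[OF assms(2)] by (subst (asm) power2_eq_iff_nonneg) auto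
    then show ?thesis using r(1) by simp
  qed
  have "Re z * Re w = - (e * e) * k\<^sup>2 * Im z * Im w" by (simp add: assms(3,4) power2_eq_square)
  then have "cosh (hdist z w) = ((exp s)\<^sup>2 + (exp t)\<^sup>2) / (2 * Im z * Im w) + k\<^sup>2"
    unfolding cosh_hdist[OF assms(1,2)] assms(6,7)
    using H2_Im_pos[OF assms(1)] H2_Im_pos[OF assms(2)] assms(5) by (simp add: field_simps)
  also have "((exp s)\<^sup>2 + (exp t)\<^sup>2) / (2 * Im z * Im w) = r\<^sup>2 * cosh (s - t)"
    using r(1) by (simp add: Iz Iw cosh_field_def exp_diff field_simps power2_eq_square)
  finally show ?thesis by (simp add: r(2))
qed

subsection \<open>Lifting to the universal cover\<close>

text \<open>Used to change the covering \<open>q\<close> by an isometry. The new sheets over an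
  evenly covered set are the images under \<open>f'\<close> of the old ones.\<close>

lemma covering_space_homeomorphism_comp:
  assumes cov: "covering_space C p S" and hom: "homeomorphism B C f f'"
  shows "covering_space B (p \<circ> f) S"
proof
  have fB: "f ` B = C" and f'C: "f' ` C = B" and f'f: "\<And>x. x \<in> B \<Longrightarrow> f' (f x) = x"
    and ff': "\<And>y. y \<in> C \<Longrightarrow> f (f' y) = y"
    and cf: "continuous_on B f"
    using hom by (auto simp: homeomorphism_def)
  show "continuous_on B (p \<circ> f)"
    using covering_space_imp_continuous[OF cov] cf fB by (intro continuous_on_compose) auto
  show "(p \<circ> f) ` B = S"
    using covering_space_imp_surjective[OF cov] fB by (metis image_comp)
  fix x assume "x \<in> S"
  then obtain T v where T: "x \<in> T" "openin (top_of_set S) T" and v: "\<Union> v = C \<inter> p -` T"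
    "\<And>u. u \<in> v \<Longrightarrow> openin (top_of_set C) u" "pairwise disjnt v"
    "\<And>u. u \<in> v \<Longrightarrow> \<exists>q. homeomorphism u T p q"
    using cov unfolding covering_space_def by metis
  have uC: "u \<subseteq> C" if "u \<in> v" for u using v(1) that by blast
  let ?v = "(\<lambda>u. f' ` u) ` v"
  have 1: "\<Union> ?v = B \<inter> (p \<circ> f) -` T"
  proof -
    have "\<Union> ?v = f' ` (C \<inter> p -` T)" unfolding v(1)[symmetric] by blast
    also have "\<dots> = B \<inter> (p \<circ> f) -` T"
      using f'C ff' f'f fB by (force simp: image_iff)
    finally show ?thesis .
  qed
  have 2: "openin (top_of_set B) u" if "u \<in> ?v" for u
    using that v(2) homeomorphism_imp_open_map[OF homeomorphism_symD[OF hom]] by blast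
  have 3: "pairwise disjnt ?v"
  proof (rule pairwiseI)
    fix u1 u2 assume u: "u1 \<in> ?v" "u2 \<in> ?v" "u1 \<noteq> u2"
    then obtain w1 w2 where w: "w1 \<in> v" "w2 \<in> v" "u1 = f' ` w1" "u2 = f' ` w2" by auto
    then have "w1 \<inter> w2 = {}" using v(3) u(3) unfolding pairwise_def disjnt_def by metis
    then show "disjnt u1 u2"
      using w(3,4) inj_on_image_Int[OF inj_on_inverseI[of C f f', OF ff'] uC[OF w(1)] uC[OF w(2)]]
      by (simp add: disjnt_def)
  qed
  have 4: "\<exists>q. homeomorphism u T (p \<circ> f) q" if u: "u \<in> ?v" for u
  proof -
    obtain w q where w: "w \<in> v" "u = f' ` w" "homeomorphism w T p q" using u v(4) by blast
    have "f ` u = w" using w(2) ff' uC[OF w(1)] by (force simp: image_iff)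
    moreover have "u \<subseteq> B" using w f'C uC by blast
    ultimately have "homeomorphism u w f f'"
      using homeomorphism_of_subsets[OF hom] uC[OF w(1)] by blast
    then show ?thesis using homeomorphism_compose w(3) by blast
  qed
  show "\<exists>T. x \<in> T \<and> openin (top_of_set S) T \<and> (\<exists>v. \<Union> v = B \<inter> (p \<circ> f) -` T \<and>
      (\<forall>u\<in>v. openin (top_of_set B) u) \<and> pairwise disjnt v \<and> (\<forall>u\<in>v. \<exists>q. homeomorphism u T (p \<circ> f) q))"
    by (rule exI[of _ T], intro conjI T exI[of _ ?v] ballI) (fact 1, fact 2, fact 3, fact 4)
qed

lemma compact_hyperbolic_cball:
  assumes z: "z \<in> H2" and r: "r \<ge> 0"
  shows "compact {w \<in> H2. hdist z w \<le> r}"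
proof -
  define M where "M = 2 * Im z * (cosh r - 1)"
  have y: "Im z > 0" using z by (simp add: H2_def)
  have M: "M \<ge> 0" using y cosh_real_ge_1[of r] by (simp add: M_def)
  have iff: "hdist z w \<le> r \<longleftrightarrow> (cmod (z - w))\<^sup>2 \<le> M * Im w" if w: "w \<in> H2" for w
  proof -
    have "hdist z w \<le> r \<longleftrightarrow> cosh (hdist z w) \<le> cosh r"
      using r hdist_nonneg[OF z w] by (simp add: cosh_real_nonneg_le_iff)
    also have "\<dots> \<longleftrightarrow> 2 * Im z * Im w * (cosh (hdist z w) - 1) \<le> 2 * Im z * Im w * (cosh r - 1)"
      using y H2_Im_pos[OF w] by simp
    also have "\<dots> \<longleftrightarrow> (cmod (z - w))\<^sup>2 \<le> M * Im w"
      unfolding norm_diff_hdist[OF z w] by (simp add: M_def mult_ac)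
    finally show ?thesis .
  qed
  \<comment> \<open>Allowing Im w = 0 makes the condition closed in the whole plane and adds no
    points, because there the inequality would force w = z.\<close>
  have eq: "{w \<in> H2. hdist z w \<le> r} = {w. 0 \<le> Im w \<and> (cmod (z - w))\<^sup>2 \<le> M * Im w}"
  proof -
    have "Im w \<noteq> 0" if "(cmod (z - w))\<^sup>2 \<le> M * Im w" for w
      using that y by auto
    then show ?thesis using iff by (auto simp: H2_def order_less_le)
  qed
  have "closed {w. 0 \<le> Im w \<and> (cmod (z - w))\<^sup>2 \<le> M * Im w}"
    by (intro closed_Collect_conj closed_Collect_le continuous_intros)
  moreover have "{w \<in> H2. hdist z w \<le> r} \<subseteq> cball z (sqrt (2 * M * Im z + M\<^sup>2))"
  proof
    fix w assume "w \<in> {w \<in> H2. hdist z w \<le> r}"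
    then have w: "w \<in> H2" "hdist z w \<le> r" by auto
    define k where "k = 2 * Im z * (cosh (hdist z w) - 1)"
    have k: "0 \<le> k" "k \<le> M"
      using w r hdist_nonneg[OF z w(1)] y cosh_real_ge_1[of "hdist z w"]
      by (auto simp: k_def M_def cosh_real_nonneg_le_iff)
    have "(cmod (z - w))\<^sup>2 \<le> 2 * k * Im z + k\<^sup>2" by (rule norm_diff_le_hdist[OF z w(1) k_def])
    also have "\<dots> \<le> 2 * M * Im z + M\<^sup>2"
      using k y by (intro add_mono mult_right_mono power_mono) auto
    finally show "w \<in> cball z (sqrt (2 * M * Im z + M\<^sup>2))"
      by (simp add: dist_norm real_le_rsqrt)
  qed
  ultimately show ?thesis
    unfolding compact_eq_bounded_closed eq[symmetric] using bounded_cball bounded_subset by blast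
qed

section \<open>Deck transformations and the quotient distance\<close>

locale hyperbolic_surface =
  fixes S :: "'a::t2_space set" and q :: "complex \<Rightarrow> 'a"
  assumes metric: "hyperbolic_metric S q"
begin

definition deck :: "(complex \<Rightarrow> complex) \<Rightarrow> bool" where
  "deck f \<longleftrightarrow> H2_isometry f \<and> (\<forall>u\<in>H2. q (f u) = q u)"

lemma deckD:
  assumes "deck f"
  shows "z \<in> H2 \<Longrightarrow> f z \<in> H2" "z \<in> H2 \<Longrightarrow> q (f z) = q z"
    "z \<in> H2 \<Longrightarrow> w \<in> H2 \<Longrightarrow> hdist (f z) (f w) = hdist z w" "continuous_on H2 f"
  using assms H2_isometryD H2_isometry_continuous by (auto simp: deck_def)

lemma deck_comp: "deck f \<Longrightarrow> deck f' \<Longrightarrow> deck (f \<circ> f')"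
  using deckD(1,2) H2_isometry_comp by (simp add: deck_def)

lemma covering: "covering_space H2 q S"
  using metric by (simp add: hyperbolic_metric_def)

lemma deck_transitive:
  assumes "z \<in> H2" "w \<in> H2" "q z = q w"
  obtains f where "deck f" "f z = w"
  using metric assms by (auto simp: hyperbolic_metric_def deck_def)

lemma q_in_S: "z \<in> H2 \<Longrightarrow> q z \<in> S"
  using covering_space_imp_surjective[OF covering] by blast

lemma lift_unique:
  fixes G1 G2 :: "'b::topological_space \<Rightarrow> complex"
  assumes "connected T" "continuous_on T G1" "continuous_on T G2"
    and "\<And>x. x \<in> T \<Longrightarrow> G1 x \<in> H2" "\<And>x. x \<in> T \<Longrightarrow> G2 x \<in> H2"
    and "\<And>x. x \<in> T \<Longrightarrow> q (G1 x) = q (G2 x)"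
    and "a \<in> T" "G1 a = G2 a" "x \<in> T"
  shows "G1 x = G2 x"
proof (rule covering_space_lift_unique[OF covering, of G1 a G2 T "q \<circ> G1"])
  show "continuous_on T (q \<circ> G1)"
    using covering_space_imp_continuous[OF covering] assms
    by (intro continuous_on_compose) (auto intro: continuous_on_subset)
qed (use assms q_in_S in auto)

text \<open>Transitivity on fibres gives a deck transformation that matches the lifts at one point;
  uniqueness of lifts spreads the agreement over the connected domain.\<close>

lemma lift_deck:
  fixes G1 G2 :: "'b::topological_space \<Rightarrow> complex"
  assumes T: "connected T" "continuous_on T G1" "continuous_on T G2"
    and H: "\<And>x. x \<in> T \<Longrightarrow> G1 x \<in> H2" "\<And>x. x \<in> T \<Longrightarrow> G2 x \<in> H2"
    and q: "\<And>x. x \<in> T \<Longrightarrow> q (G1 x) = q (G2 x)" and "T \<noteq> {}"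
  obtains f where "deck f" "\<And>x. x \<in> T \<Longrightarrow> G2 x = f (G1 x)"
proof -
  obtain a where a: "a \<in> T" using \<open>T \<noteq> {}\<close> by blast
  obtain f where f: "deck f" "f (G1 a) = G2 a"
    using deck_transitive[of "G1 a" "G2 a"] H q a by blast
  have "G2 x = (f \<circ> G1) x" if "x \<in> T" for x
  proof (rule lift_unique[of T G2 "f \<circ> G1" a x])
    show "continuous_on T (f \<circ> G1)"
      using T H deckD(4)[OF f(1)] by (intro continuous_on_compose) (auto intro: continuous_on_subset)
  qed (use T H q a f that deckD[OF f(1)] in auto)
  then show thesis using that f by simp
qed

lemma surface_dist_le:
  assumes "z \<in> H2" "w \<in> H2"
  shows "surface_dist q (q z) (q w) \<le> hdist z w"
  unfolding surface_dist_def
proof (rule cInf_lower)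
  show "bdd_below {hdist z' w' |z' w'. z' \<in> H2 \<and> w' \<in> H2 \<and> q z' = q z \<and> q w' = q w}"
    by (rule bdd_belowI[of _ 0]) (auto intro: hdist_nonneg)
qed (use assms in auto)

text \<open>The infimum defining the distance is attained because a fibre is closed and closed hyperbolic
  balls are compact.\<close>

lemma surface_dist_attained:
  assumes z: "z \<in> H2" and w0: "w0 \<in> H2" and k: "k \<ge> 0" and le: "surface_dist q (q z) (q w0) \<le> k"
  obtains w where "w \<in> H2" "q w = q w0" "hdist z w \<le> k"
proof -
  define X where "X = {hdist z' w' |z' w'. z' \<in> H2 \<and> w' \<in> H2 \<and> q z' = q z \<and> q w' = q w0}"
  have X: "\<exists>w\<in>H2. q w = q w0 \<and> hdist z w = x" if x: "x \<in> X" for x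
  proof -
    obtain z' w' where zw: "z' \<in> H2" "w' \<in> H2" "q z' = q z" "q w' = q w0" "x = hdist z' w'"
      using x by (auto simp: X_def)
    obtain f where f: "deck f" "f z' = z" using deck_transitive[OF zw(1) z zw(3)] .
    then show ?thesis using zw deckD[OF f(1)] by metis
  qed
  have Xne: "X \<noteq> {}" using z w0 by (auto simp: X_def)
  \<comment> \<open>The margin 1 guarantees that the compact ball meets the fibre: the infimum is
    strictly below k + 1, though a priori no value need be at most k.\<close>
  define B where "B = {w \<in> H2. hdist z w \<le> k + 1}"
  have cB: "compact B" unfolding B_def using compact_hyperbolic_cball[OF z] k by simp
  have BH: "B \<subseteq> H2" by (auto simp: B_def)
  have "continuous_on B q" using covering_space_imp_continuous[OF covering] BH continuous_on_subset by blast
  then have "closedin (top_of_set B) (B \<inter> q -` {q w0})"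
    by (intro continuous_closedin_preimage) auto
  then have cW: "compact (B \<inter> q -` {q w0})" using cB closedin_compact by blast
  have "Inf X < k + 1" using le by (simp add: surface_dist_def X_def)
  then obtain x where "x \<in> X" "x < k + 1" using cInf_lessD[OF Xne] by blast
  then have "B \<inter> q -` {q w0} \<noteq> {}" using X by (force simp: B_def)
  moreover have "continuous_on (B \<inter> q -` {q w0}) (hdist z)"
    using continuous_on_hdist[OF z] BH by (meson Int_lower1 continuous_on_subset)
  ultimately obtain w where w: "w \<in> B \<inter> q -` {q w0}" "\<And>u. u \<in> B \<inter> q -` {q w0} \<Longrightarrow> hdist z w \<le> hdist z u"
    using continuous_attains_inf[OF cW] by blast
  have "hdist z w \<le> Inf X"
  proof (rule cInf_greatest[OF Xne])
    fix x assume "x \<in> X"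
    then obtain u where u: "u \<in> H2" "q u = q w0" "hdist z u = x" using X by blast
    show "hdist z w \<le> x"
    proof (cases "x \<le> k + 1")
      case True
      then show ?thesis using w(2)[of u] u by (auto simp: B_def)
    next
      case False
      then show ?thesis using w(1) by (auto simp: B_def)
    qed
  qed
  then show thesis using that[of w] w(1) le by (auto simp: B_def surface_dist_def X_def)
qed

end

subsection \<open>The annulus and its universal cover\<close>

text \<open>The deck transformations of \<open>ann_cover\<close>; 2 is the circumference of the
  circle R/2Z.\<close>

definition shift :: "int \<Rightarrow> real \<times> real \<Rightarrow> real \<times> real" where
  "shift k z = (fst z + 2 * of_int k, snd z)"

lemma shift_strip [simp]: "shift k z \<in> strip \<longleftrightarrow> z \<in> strip"
  by (cases z) (simp add: shift_def strip_def)

lemma shift_shift [simp]: "shift k (shift j z) = shift (k + j) z"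
  by (simp add: shift_def)

lemma shift_0 [simp]: "shift 0 z = z"
  by (simp add: shift_def)

lemma continuous_on_shift: "continuous_on T (shift k)"
  unfolding shift_def by (intro continuous_intros)

lemma ann_cover_eq_iff: "ann_cover z = ann_cover w \<longleftrightarrow> (\<exists>k. z = shift k w)"
proof -
  have "cis (pi * x) = cis (pi * y) \<longleftrightarrow> (\<exists>k::int. x = y + 2 * of_int k)" for x y
  proof -
    have "cis (pi * x) = cis (pi * y) \<longleftrightarrow> sin (pi * x) = sin (pi * y) \<and> cos (pi * x) = cos (pi * y)"
      by (auto simp: complex_eq_iff)
    also have "\<dots> \<longleftrightarrow> (\<exists>k::int. pi * x = pi * y + 2 * pi * of_int k)"
      by (rule sin_cos_eq_iff)
    also have "\<dots> \<longleftrightarrow> (\<exists>k::int. pi * x = pi * (y + 2 * of_int k))"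
      by (simp add: algebra_simps)
    also have "\<dots> \<longleftrightarrow> (\<exists>k::int. x = y + 2 * of_int k)" by simp
    finally show ?thesis .
  qed
  then show ?thesis by (cases z; cases w) (auto simp: ann_cover_def shift_def)
qed

lemma ann_cover_annulus: "z \<in> strip \<Longrightarrow> ann_cover z \<in> std_annulus"
  by (auto simp: ann_cover_def std_annulus_def strip_def)

lemma continuous_on_ann_cover: "continuous_on T ann_cover"
  unfolding ann_cover_def split_def by (intro continuous_intros)

lemma convex_strip: "convex strip"
  unfolding strip_def by (intro convex_Times) auto

lemma linepath_in_strip:
  assumes "z \<in> strip" "w \<in> strip" "t \<in> {0..1}"
  shows "linepath z w t \<in> strip"
  using linepath_in_path[OF assms(3)] closed_segment_subset[OF assms(1,2) convex_strip] by blast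

lemma ann_circle_cover: "ann_circle 0 = range (\<lambda>x. ann_cover (x, 0))"
proof -
  have "sphere 0 1 = range (\<lambda>x. cis (pi * x))"
  proof -
    have "\<exists>x. z = cis (pi * x)" if "cmod z = 1" for z
    proof -
      have "z = cis (pi * (Arg z / pi))" using that by (metis complex_unimodular_polar cis_Arg_unique nonzero_mult_div_cancel_left pi_neq_zero rcis_cmod_Arg rcis_def mult_1 of_real_1 times_divide_eq_right)
      then show ?thesis by blast
    qed
    then show ?thesis by (auto simp: image_iff)
  qed
  then show ?thesis by (auto simp: ann_circle_def ann_cover_def)
qed

text \<open>By compactness \<open>h\<close> is an embedding, and the angle lifts because a function
  without zeros on a contractible set has a continuous logarithm. The domains of interest are the
  real line, the cone and the square of a homotopy.\<close>

lemma annulus_lift: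
  fixes w :: "'b::real_normed_vector \<Rightarrow> 'a::t2_space"
  assumes h: "continuous_on std_annulus h" "inj_on h std_annulus"
    and T: "contractible T" and w: "continuous_on T w" "\<And>x. x \<in> T \<Longrightarrow> w x \<in> h ` std_annulus"
  obtains W where "continuous_on T W" "\<And>x. x \<in> T \<Longrightarrow> W x \<in> strip" "\<And>x. x \<in> T \<Longrightarrow> h (ann_cover (W x)) = w x"
proof -
  have "compact std_annulus" unfolding std_annulus_def by (intro compact_Times) auto
  then obtain h' where h': "homeomorphism std_annulus (h ` std_annulus) h h'"
    using homeomorphism_compact[OF _ h(1) refl h(2)] by blast
  define u where "u = h' \<circ> w"
  have u: "u x \<in> std_annulus" "h (u x) = w x" if "x \<in> T" for x
    using h' w(2)[OF that] by (auto simp: u_def homeomorphism_def)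
  have cu: "continuous_on T u"
    unfolding u_def using h' w by (intro continuous_on_compose)
      (auto simp: homeomorphism_def intro: continuous_on_subset)
  have n: "cmod (fst (u x)) = 1" "snd (u x) \<in> {-1..1}" if "x \<in> T" for x
    using u(1)[OF that] by (auto simp: std_annulus_def mem_Times_iff)
  then have nz: "fst (u x) \<noteq> 0" if "x \<in> T" for x using that by force
  have "continuous_on T (\<lambda>x. fst (u x))" using cu by (intro continuous_intros)
  then obtain g where g: "continuous_on T g" "\<And>x. x \<in> T \<Longrightarrow> fst (u x) = exp (g x)"
    by (rule continuous_logarithm_on_contractible[OF _ T nz]) auto
  define W where "W = (\<lambda>x. (Im (g x) / pi, snd (u x)))"
  show thesis
  proof
    show "continuous_on T W" unfolding W_def using g cu by (intro continuous_intros) auto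
    show "W x \<in> strip" if "x \<in> T" for x using n(2)[OF that] by (simp add: W_def strip_def)
    show "h (ann_cover (W x)) = w x" if "x \<in> T" for x
    proof -
      have "cmod (exp (g x)) = 1" using n(1)[OF that] g(2)[OF that] by simp
      then have "Re (g x) = 0" by (simp add: norm_exp_eq_Re)
      then have "cis (Im (g x)) = exp (g x)" by (simp add: exp_eq_polar)
      then have "ann_cover (W x) = u x"
        using g(2)[OF that] by (simp add: ann_cover_def W_def prod_eq_iff)
      then show ?thesis using u(2)[OF that] by simp
    qed
  qed
qed

subsection \<open>The development of a collar\<close>

text \<open>The normalised situation, in which the core develops to the imaginary axis itself; the
  general case is reduced to it by an isometry. The map \<open>\<theta>\<close> is arc length along
  the core as a function of the strip coordinate; it is only monotone and onto, because
  \<open>h\<close> need not have constant speed.\<close>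

locale developed_collar = hyperbolic_surface S q for S :: "'a::t2_space set" and q +
  fixes h :: "complex \<times> real \<Rightarrow> 'a" and F :: "real \<times> real \<Rightarrow> complex" and \<theta> :: "real \<Rightarrow> real" and a :: real
  assumes h: "continuous_on std_annulus h" "inj_on h std_annulus"
    and core: "closed_geodesic q (h ` ann_circle 0) (2 * a)"
    and collar: "h ` std_annulus = {x \<in> S. \<exists>y \<in> h ` ann_circle 0. surface_dist q x y \<le> collar_width a}"
    and F_cont: "continuous_on strip F"
    and F_H2: "z \<in> strip \<Longrightarrow> F z \<in> H2"
    and q_F: "z \<in> strip \<Longrightarrow> q (F z) = h (ann_cover z)"
    and \<theta>: "strict_mono \<theta>" "surj \<theta>"
    and F_axis: "F (x, 0) = im_axis (\<theta> x)"
begin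

definition K :: real where "K = 1 / sinh a"

text \<open>The translation length along the axis of one turn around the core; \<open>c_eq\<close>
  identifies it with 2 a.\<close>

definition c :: real where "c = \<theta> 2 - \<theta> 0"

lemma a_pos: "a > 0"
  using core by (simp add: closed_geodesic_def)

lemma K_pos: "K > 0"
  using a_pos by (simp add: K_def)

lemma collar_width_K: "collar_width a = arsinh K"
  by (simp add: collar_width_def K_def)

lemma axis_strip [simp]: "(x, 0) \<in> strip"
  by (simp add: strip_def)

lemma h_ann_cover_eqD:
  assumes "z \<in> strip" "w \<in> strip" "h (ann_cover z) = h (ann_cover w)"
  obtains k where "z = shift k w"
  using assms h(2) ann_cover_annulus ann_cover_eq_iff by (metis inj_onD)

lemma h_ann_cover_shift: "h (ann_cover (shift k z)) = h (ann_cover z)"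
  using ann_cover_eq_iff by metis

lemma connected_strip: "connected strip"
  by (simp add: convex_connected convex_strip)

lemma F_shift_cont: "continuous_on strip (\<lambda>z. F (shift k z))"
  by (rule continuous_on_compose2[OF F_cont continuous_on_shift]) auto

section \<open>Deck translations and the length of the core\<close>

lemma F_shift_deck:
  obtains f where "deck f" "\<And>z. z \<in> strip \<Longrightarrow> F (shift k z) = f (F z)"
proof (rule lift_deck[of strip F "\<lambda>z. F (shift k z)"])
  show "strip \<noteq> {}" using axis_strip by blast
qed (use connected_strip F_cont F_shift_cont F_H2 q_F h_ann_cover_shift in auto)

text \<open>The deck transformation that realises \<open>shift 1\<close> acts on the axis by an
  isometry of the line, and monotonicity of \<open>\<theta>\<close> excludes a reflection.\<close>

lemma theta_shift1: "\<theta> (x + 2) = \<theta> x + c"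
proof -
  obtain f where f: "deck f" "\<And>z. z \<in> strip \<Longrightarrow> F (shift 1 z) = f (F z)"
    by (rule F_shift_deck, rule that)
  have "im_axis (\<theta> (y + 2)) = f (im_axis (\<theta> y))" for y
    using f(2)[of "(y, 0)"] by (simp add: shift_def F_axis)
  then have "hdist (im_axis (\<theta> (x + 2))) (im_axis (\<theta> (0 + 2))) = hdist (im_axis (\<theta> x)) (im_axis (\<theta> 0))"
    using deckD(3)[OF f(1) im_axis_H2 im_axis_H2, of "\<theta> x" "\<theta> 0"] by metis
  then have "\<bar>\<theta> (x + 2) - \<theta> (0 + 2)\<bar> = \<bar>\<theta> x - \<theta> 0\<bar>" by (simp only: hdist_axis)
  moreover have "\<theta> (x + 2) - \<theta> (0 + 2) \<ge> 0 \<longleftrightarrow> \<theta> x - \<theta> 0 \<ge> 0"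
    using strict_mono_less_eq[OF \<theta>(1)] by auto
  ultimately have "\<theta> (x + 2) - \<theta> (0 + 2) = \<theta> x - \<theta> 0" by linarith
  then show ?thesis by (simp add: c_def)
qed

lemma theta_shift: "\<theta> (x + 2 * of_int k) = \<theta> x + of_int k * c"
proof -
  have n: "\<theta> (x + 2 * real n) = \<theta> x + real n * c" for x n
  proof (induction n)
    case (Suc n)
    have "x + 2 * real (Suc n) = (x + 2 * real n) + 2" by simp
    then show ?case using theta_shift1[of "x + 2 * real n"] Suc by (simp add: algebra_simps)
  qed simp
  show ?thesis
  proof (cases "k \<ge> 0")
    case True
    then show ?thesis using n[of x "nat k"] by simp
  next
    case False
    then show ?thesis using n[of "x + 2 * of_int k" "nat (- k)"] by simp
  qed
qed

lemma c_pos: "c > 0"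
  using strict_monoD[OF \<theta>(1), of 0 2] by (simp add: c_def)

text \<open>Any parametrisation of the core lifts to the imaginary axis up to a deck transformation, so its
  period is the translation length \<open>c\<close>.\<close>

lemma closed_geodesic_length:
  assumes "closed_geodesic q (h ` ann_circle 0) L"
  shows "L = c"
proof -
  obtain \<sigma> where L: "L > 0" and \<sigma>: "geodesic_line \<sigma>" and C: "h ` ann_circle 0 = range (q \<circ> \<sigma>)"
    and per: "\<And>s t. q (\<sigma> s) = q (\<sigma> t) \<longleftrightarrow> (\<exists>k::int. s - t = of_int k * L)"
    using assms unfolding closed_geodesic_def by blast
  have \<sigma>H: "\<sigma> s \<in> H2" and \<sigma>d: "hdist (\<sigma> s) (\<sigma> t) = \<bar>s - t\<bar>" for s t
    using \<sigma> by (auto simp: geodesic_line_def)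
  have c\<sigma>: "continuous_on UNIV \<sigma>"
    by (rule continuous_on_constant_speed[of UNIV \<sigma> 1]) (simp_all add: \<sigma>H \<sigma>d)
  have cq: "continuous_on UNIV (q \<circ> \<sigma>)"
    using covering_space_imp_continuous[OF covering] \<sigma>H
    by (intro continuous_on_compose c\<sigma>) (auto intro: continuous_on_subset)
  have sub: "ann_circle 0 \<subseteq> std_annulus" by (auto simp: ann_circle_def std_annulus_def)
  obtain W where W: "continuous_on UNIV W" "\<And>s. W s \<in> strip" "\<And>s. h (ann_cover (W s)) = q (\<sigma> s)"
  proof (rule annulus_lift[OF h, of "UNIV :: real set" "q \<circ> \<sigma>"])
    show "contractible (UNIV :: real set)" by (simp add: convex_imp_contractible)
    show "(q \<circ> \<sigma>) s \<in> h ` std_annulus" for s using C sub by blast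
  qed (use cq in auto)
  define \<phi> where "\<phi> = (\<lambda>s. fst (W s))"
  have W0: "W s = (\<phi> s, 0)" for s
  proof -
    have "h (ann_cover (W s)) \<in> h ` ann_circle 0" unfolding W(3) C by simp
    then have "ann_cover (W s) \<in> ann_circle 0"
      using h(2) sub ann_cover_annulus[OF W(2)] by (meson inj_on_image_mem_iff)
    then show ?thesis by (cases "W s") (auto simp: ann_cover_def ann_circle_def \<phi>_def)
  qed
  obtain f where f: "deck f" "\<And>s. \<sigma> s = f (F (W s))"
  proof (rule lift_deck[of "UNIV :: real set" "\<lambda>s. F (W s)" \<sigma>])
    show "continuous_on UNIV (\<lambda>s. F (W s))"
      by (rule continuous_on_compose2[OF F_cont W(1)]) (use W(2) in auto)
  qed (use c\<sigma> \<sigma>H W F_H2 q_F in auto)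
  have iso: "\<bar>\<theta> (\<phi> s) - \<theta> (\<phi> t)\<bar> = \<bar>s - t\<bar>" for s t
  proof -
    have "hdist (\<sigma> s) (\<sigma> t) = hdist (im_axis (\<theta> (\<phi> s))) (im_axis (\<theta> (\<phi> t)))"
      using deckD(3)[OF f(1) im_axis_H2 im_axis_H2] by (simp add: f(2) W0 F_axis)
    then show ?thesis by (simp add: \<sigma>d hdist_axis)
  qed
  \<comment> \<open>The absolute value covers both directions in which \<open>\<sigma>\<close> may
    run around the core.\<close>
  have per': "q (\<sigma> s) = q (\<sigma> t) \<longleftrightarrow> (\<exists>k::int. \<bar>s - t\<bar> = of_int k * c)" for s t
  proof -
    have "q (\<sigma> s) = q (\<sigma> t) \<longleftrightarrow> (\<exists>k::int. \<phi> s = \<phi> t + 2 * of_int k)"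
    proof
      assume "q (\<sigma> s) = q (\<sigma> t)"
      then have "h (ann_cover (W s)) = h (ann_cover (W t))" by (simp add: W(3))
      then obtain k where "W s = shift k (W t)" using h_ann_cover_eqD W(2) by blast
      then show "\<exists>k::int. \<phi> s = \<phi> t + 2 * of_int k" by (auto simp: W0 shift_def)
    next
      assume "\<exists>k::int. \<phi> s = \<phi> t + 2 * of_int k"
      then obtain k where "W s = shift k (W t)" by (auto simp: W0 shift_def)
      then show "q (\<sigma> s) = q (\<sigma> t)" by (metis W(3) h_ann_cover_shift)
    qed
    also have "\<dots> \<longleftrightarrow> (\<exists>k::int. \<theta> (\<phi> s) = \<theta> (\<phi> t) + of_int k * c)"
      using strict_mono_eq[OF \<theta>(1)] by (simp flip: theta_shift)
    also have "\<dots> \<longleftrightarrow> (\<exists>k::int. \<bar>\<theta> (\<phi> s) - \<theta> (\<phi> t)\<bar> = of_int k * c)"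
    proof
      assume "\<exists>k::int. \<theta> (\<phi> s) = \<theta> (\<phi> t) + of_int k * c"
      then obtain k :: int where "\<theta> (\<phi> s) = \<theta> (\<phi> t) + of_int k * c" ..
      then have "\<bar>\<theta> (\<phi> s) - \<theta> (\<phi> t)\<bar> = of_int \<bar>k\<bar> * c" using c_pos by (simp add: abs_mult)
      then show "\<exists>k::int. \<bar>\<theta> (\<phi> s) - \<theta> (\<phi> t)\<bar> = of_int k * c" ..
    next
      assume "\<exists>k::int. \<bar>\<theta> (\<phi> s) - \<theta> (\<phi> t)\<bar> = of_int k * c"
      then obtain k :: int where "\<bar>\<theta> (\<phi> s) - \<theta> (\<phi> t)\<bar> = of_int k * c" ..
      then have "\<theta> (\<phi> s) = \<theta> (\<phi> t) + of_int k * c \<or> \<theta> (\<phi> s) = \<theta> (\<phi> t) + of_int (- k) * c" by auto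
      then show "\<exists>k::int. \<theta> (\<phi> s) = \<theta> (\<phi> t) + of_int k * c" by blast
    qed
    finally show ?thesis by (simp add: iso)
  qed
  \<comment> \<open>Each of the positive periods \<open>L\<close> and \<open>c\<close> is an integer
    multiple of the other, so they agree.\<close>
  have "q (\<sigma> L) = q (\<sigma> 0)" using per[of L 0] by (simp add: exI[of _ 1])
  then obtain k :: int where k: "L = of_int k * c" using per'[of L 0] L by auto
  have "q (\<sigma> c) = q (\<sigma> 0)" using per'[of c 0] c_pos by (simp add: exI[of _ 1])
  then obtain j :: int where j: "c = of_int j * L" using per[of c 0] by auto
  have kj: "real_of_int (j * k) = 1" using j k c_pos by simp
  then have "j * k = 1" by linarith
  moreover have "k > 0" using k L c_pos by (simp add: zero_less_mult_iff)
  ultimately have "k = 1" using zmult_eq_1_iff[of j k] by auto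
  then show ?thesis using k by simp
qed

lemma c_eq: "c = 2 * a"
  using closed_geodesic_length[OF core] by simp

text \<open>The deck transformation behind \<open>shift k\<close> translates the axis by k c, so
  distances to the axis fix the modulus and the height of the image. The sign of its real part stays
  open.\<close>

lemma F_shift:
  assumes "z \<in> strip"
  shows "cmod (F (shift k z)) = exp (of_int k * c) * cmod (F z)"
    "Im (F (shift k z)) = exp (of_int k * c) * Im (F z)"
proof -
  obtain f where f: "deck f" "\<And>z. z \<in> strip \<Longrightarrow> F (shift k z) = f (F z)"
    by (rule F_shift_deck, rule that)
  have ax: "im_axis (s + of_int k * c) = f (im_axis s)" for s
  proof -
    obtain x where "s = \<theta> x" using \<theta>(2) by (rule surjE)
    then show ?thesis
      using f(2)[of "(x, 0)"] theta_shift[of x k] by (simp add: shift_def F_axis)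
  qed
  have d: "hdist (F z) (im_axis s) = hdist (F (shift k z)) (im_axis (s + of_int k * c))" for s
    using deckD(3)[OF f(1) F_H2[OF assms] im_axis_H2] by (simp add: ax f(2)[OF assms])
  have H: "F (shift k z) \<in> H2" using assms by (simp add: F_H2)
  from hdist_axis_determines[OF F_H2[OF assms] H _ d d, of 0 1]
  show "cmod (F (shift k z)) = exp (of_int k * c) * cmod (F z)"
    "Im (F (shift k z)) = exp (of_int k * c) * Im (F z)" by auto
qed

section \<open>The strip develops onto the cone\<close>

lemma F_shift_cone:
  assumes "z \<in> strip" "F (shift k z) \<in> cone K"
  shows "F z \<in> cone K"
proof -
  let ?e = "exp (of_int k * c)"
  have "(Re (F (shift k z)))\<^sup>2 = (?e * Re (F z))\<^sup>2"
    using F_shift[OF assms(1), of k] cmod_power2[of "F z"] cmod_power2[of "F (shift k z)"]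
    by (simp add: power_mult_distrib algebra_simps)
  then have "\<bar>Re (F (shift k z))\<bar> = ?e * \<bar>Re (F z)\<bar>"
    by (metis abs_exp_cancel abs_mult power2_eq_iff abs_minus_cancel)
  then show ?thesis using assms F_H2 F_shift(2)[OF assms(1), of k] by (simp add: cone_def)
qed

lemma q_cone:
  assumes "z \<in> cone K" shows "q z \<in> h ` std_annulus"
proof -
  have z: "z \<in> H2" using assms by (simp add: cone_def)
  then obtain s where s: "hdist z (im_axis s) \<le> arsinh K"
    using cone_iff[OF z, of K] assms K_pos by auto
  obtain x where x: "s = \<theta> x" using \<theta>(2) by (rule surjE)
  have "q (im_axis s) = h (ann_cover (x, 0))" using q_F[of "(x, 0)"] by (simp add: F_axis x)
  then have "q (im_axis s) \<in> h ` ann_circle 0" by (simp add: ann_circle_cover)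
  moreover have "surface_dist q (q z) (q (im_axis s)) \<le> collar_width a"
    using surface_dist_le[OF z im_axis_H2, of s] s by (simp add: collar_width_K)
  ultimately show ?thesis using q_in_S[OF z] unfolding collar by blast
qed

text \<open>The cone is contractible and \<open>q\<close> sends it into the collar, so
  \<open>q\<close> lifts to the strip. After a shift that corrects one value on the axis, developing
  this lift gives a lift of \<open>q\<close> that agrees with the identity at that point, hence
  everywhere.\<close>

lemma section_exists:
  "\<exists>W. continuous_on (cone K) W \<and> (\<forall>z\<in>cone K. W z \<in> strip \<and> F (W z) = z)"
proof -
  have sub: "cone K \<subseteq> H2" by (auto simp: cone_def)
  obtain W where W: "continuous_on (cone K) W" "\<And>z. z \<in> cone K \<Longrightarrow> W z \<in> strip"
    "\<And>z. z \<in> cone K \<Longrightarrow> h (ann_cover (W z)) = q z"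
  proof (rule annulus_lift[OF h, of "cone K" q])
    show "contractible (cone K)" by (rule convex_imp_contractible[OF convex_cone])
    show "continuous_on (cone K) q"
      using covering_space_imp_continuous[OF covering] sub continuous_on_subset by blast
  qed (use q_cone in auto)
  have i: "im_axis (\<theta> 0) \<in> cone K" using K_pos by (simp add: cone_def)
  have "h (ann_cover (W (im_axis (\<theta> 0)))) = h (ann_cover (0, 0))"
    using W(3)[OF i] q_F[of "(0, 0)"] by (simp add: F_axis)
  then obtain k where k: "W (im_axis (\<theta> 0)) = shift k (0, 0)"
    using h_ann_cover_eqD[OF W(2)[OF i] axis_strip] by blast
  define V where "V = (\<lambda>z. shift (- k) (W z))"
  have cV: "continuous_on (cone K) V"
    unfolding V_def by (rule continuous_on_compose2[OF continuous_on_shift W(1) subset_UNIV])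
  have V: "V z \<in> strip" if "z \<in> cone K" for z using W(2)[OF that] by (simp add: V_def)
  have "F (V z) = z" if z: "z \<in> cone K" for z
  proof (rule lift_unique[of "cone K" "\<lambda>z. F (V z)" "\<lambda>z. z" "im_axis (\<theta> 0)"])
    show "connected (cone K)" by (rule convex_connected[OF convex_cone])
    show "continuous_on (cone K) (\<lambda>z. F (V z))"
      by (rule continuous_on_compose2[OF F_cont cV]) (use V in auto)
    show "q (F (V z)) = q z" if "z \<in> cone K" for z
      using q_F[OF V[OF that]] W(3)[OF that] by (simp add: V_def h_ann_cover_shift)
    show "F (V (im_axis (\<theta> 0))) = im_axis (\<theta> 0)" by (simp add: V_def k F_axis)
  qed (use V F_H2 sub i z in auto)
  then show ?thesis using cV V by blast
qed

definition sec :: "complex \<Rightarrow> real \<times> real" where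
  "sec = (SOME W. continuous_on (cone K) W \<and> (\<forall>z\<in>cone K. W z \<in> strip \<and> F (W z) = z))"

lemma sec:
  "continuous_on (cone K) sec" "z \<in> cone K \<Longrightarrow> sec z \<in> strip" "z \<in> cone K \<Longrightarrow> F (sec z) = z"
  using someI_ex[OF section_exists, folded sec_def] by auto

text \<open>A shortest connection to the core, moved by a deck transformation, yields a point
  \<open>n\<close> of the cone over the same point of the surface. It need not be
  \<open>F z\<close>, but \<open>sec n\<close> and \<open>z\<close> differ by a shift, and
  membership in the cone is unaffected by shifts.\<close>

lemma F_cone:
  assumes z: "z \<in> strip" shows "F z \<in> cone K"
proof -
  have "q (F z) \<in> h ` std_annulus" using q_F[OF z] ann_cover_annulus[OF z] by simp
  then obtain y where y: "y \<in> h ` ann_circle 0" "surface_dist q (q (F z)) y \<le> collar_width a"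
    unfolding collar by blast
  then obtain x where "y = h (ann_cover (x, 0))" by (auto simp: ann_circle_cover)
  then have "y = q (im_axis (\<theta> x))" using q_F[of "(x, 0)"] by (simp add: F_axis)
  then obtain w where w: "w \<in> H2" "q w = q (im_axis (\<theta> x))" "hdist (F z) w \<le> arsinh K"
    using surface_dist_attained[OF F_H2[OF z] im_axis_H2, of "arsinh K" "\<theta> x"] y(2) K_pos
    by (metis collar_width_K arsinh_real_pos_iff less_eq_real_def)
  obtain f where f: "deck f" "f w = im_axis (\<theta> x)" by (rule deck_transitive[OF w(1) im_axis_H2 w(2)])
  define n where "n = f (F z)"
  have n: "n \<in> H2" "q n = q (F z)" "hdist n (im_axis (\<theta> x)) \<le> arsinh K"
    using deckD[OF f(1)] F_H2[OF z] w f(2) unfolding n_def by metis+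
  then have nK: "n \<in> cone K" using cone_iff[OF n(1), of K] K_pos by auto
  have "h (ann_cover (sec n)) = h (ann_cover z)"
    using q_F[OF sec(2)[OF nK]] q_F[OF z] n(2) sec(3)[OF nK] by simp
  then obtain k where "sec n = shift k z" using h_ann_cover_eqD[OF sec(2)[OF nK] z] by blast
  then show ?thesis using F_shift_cone[OF z] sec(3)[OF nK] nK by metis
qed

lemma F_inj:
  assumes "z \<in> strip" "w \<in> strip" "F z = F w" shows "z = w"
proof -
  have "h (ann_cover z) = h (ann_cover w)" using assms q_F by metis
  then obtain k where k: "z = shift k w" using h_ann_cover_eqD assms by blast
  have "F (shift k (0, 0)) = F (0, 0)"
    by (rule lift_unique[of strip "\<lambda>z. F (shift k z)" F w])
      (use connected_strip F_shift_cont F_cont F_H2 q_F h_ann_cover_shift assms k in auto)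
  then have "\<theta> (2 * of_int k) = \<theta> 0" by (simp add: shift_def F_axis im_axis_def)
  then have "k = 0" using strict_mono_eq[OF \<theta>(1)] by simp
  then show ?thesis using k by simp
qed

text \<open>By invariance of domain, the section maps the interior of the cone into the interior of the strip.\<close>

lemma F_boundary:
  assumes "\<bar>t\<bar> = 1"
  shows "\<bar>Re (F (x, t))\<bar> = K * Im (F (x, t))"
proof (rule ccontr)
  assume neq: "\<bar>Re (F (x, t))\<bar> \<noteq> K * Im (F (x, t))"
  have st: "(x, t) \<in> strip" using assms by (auto simp: strip_def)
  define M where "M = {z. 0 < Im z \<and> \<bar>Re z\<bar> < K * Im z}"
  have sub: "M \<subseteq> cone K" by (auto simp: M_def cone_def H2_def)
  have "open M" unfolding M_def by (intro open_Collect_conj open_Collect_less continuous_intros)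
  then have op: "open (sec ` M)"
  proof (rule invariance_of_domain_gen)
    show "continuous_on M sec" using sec(1) sub continuous_on_subset by blast
    show "inj_on sec M" using sec(3) sub by (metis inj_on_def subsetD)
  qed simp
  have FM: "F (x, t) \<in> M" using neq F_cone[OF st] by (auto simp: M_def cone_def H2_def)
  then have "F (sec (F (x, t))) = F (x, t)" using sec(3) sub by blast
  then have "sec (F (x, t)) = (x, t)" using F_inj sec(2) FM sub st by blast
  then have "(x, t) \<in> sec ` M" using FM by (metis imageI)
  then obtain e where e: "e > 0" "ball (x, t) e \<subseteq> sec ` M" using op openE by blast
  \<comment> \<open>As |t| = 1, this nearby point has second coordinate of modulus 1 + e/2 and lies
    outside the strip.\<close>
  have "(x, t + t * (e / 2)) \<in> ball (x, t) e"
    using e(1) assms by (simp add: dist_Pair_Pair dist_norm abs_mult)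
  moreover have "sec ` M \<subseteq> strip" by (intro image_subsetI sec(2) subsetD[OF sub])
  ultimately have "(x, t + t * (e / 2)) \<in> strip" using e(2) by (meson subsetD)
  then have "\<bar>t * (1 + e / 2)\<bar> \<le> 1" by (auto simp: strip_def algebra_simps)
  then have "\<bar>t\<bar> * \<bar>1 + e / 2\<bar> \<le> 1" by (simp only: abs_mult)
  then show False using assms e(1) by simp
qed

lemma F_Re_nonzero:
  assumes "z \<in> strip" "Re (F z) = 0" shows "snd z = 0"
proof -
  have "Im (F z) > 0" using F_H2[OF assms(1)] by (simp add: H2_def)
  then have "F z = im_axis (ln (Im (F z)))" using assms(2) by (simp add: complex_eq_iff)
  moreover obtain x where "ln (Im (F z)) = \<theta> x" using \<theta>(2) by (rule surjE)
  ultimately have "F z = F (x, 0)" by (simp add: F_axis)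
  then show ?thesis using F_inj[OF assms(1) axis_strip] by (metis snd_conv)
qed

lemma F_side:
  assumes "connected T" "T \<subseteq> strip" "\<And>z. z \<in> T \<Longrightarrow> snd z \<noteq> 0"
  shows "(\<forall>z\<in>T. Re (F z) > 0) \<or> (\<forall>z\<in>T. Re (F z) < 0)"
proof (rule ccontr)
  assume "\<not> ?thesis"
  then obtain z w where "z \<in> T" "w \<in> T" "Re (F z) \<le> 0" "Re (F w) \<ge> 0" by force
  moreover have "connected ((\<lambda>z. Re (F z)) ` T)"
    using F_cont assms by (intro connected_continuous_image continuous_intros)
      (auto intro: continuous_on_subset)
  ultimately have "0 \<in> (\<lambda>z. Re (F z)) ` T"
    using connectedD_interval[of _ "Re (F z)" "Re (F w)" 0] by auto
  then show False using F_Re_nonzero assms by force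
qed

text \<open>Each open half of the strip, with its boundary line, stays on one side of the axis. Both
  cannot lie on the same side, because the section reaches both sides of the cone. The sign
  \<open>e\<close> says whether \<open>F\<close> puts the upper line on the right or on the
  left.\<close>

lemma F_opposite_sides:
  obtains e where "e * e = 1" "\<And>x. Re (F (x, 1)) = e * K * Im (F (x, 1))"
    "\<And>x. Re (F (x, -1)) = - e * K * Im (F (x, -1))"
proof -
  define U where "U = (UNIV :: real set) \<times> {0<..1::real}"
  define D where "D = (UNIV :: real set) \<times> {-1..<0::real}"
  have U: "(\<forall>z\<in>U. Re (F z) > 0) \<or> (\<forall>z\<in>U. Re (F z) < 0)"
    unfolding U_def by (rule F_side) (auto simp: strip_def intro!: connected_Times)
  have D: "(\<forall>z\<in>D. Re (F z) > 0) \<or> (\<forall>z\<in>D. Re (F z) < 0)"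
    unfolding D_def by (rule F_side) (auto simp: strip_def intro!: connected_Times)
  have ex: "\<exists>z\<in>U \<union> D. e * Re (F z) > 0" if e: "e = 1 \<or> e = -1" for e :: real
  proof -
    have "Complex (e * K) 1 \<in> cone K" using e K_pos by (auto simp: cone_def H2_def)
    note w = sec(2,3)[OF this]
    define z where "z = sec (Complex (e * K) 1)"
    have "snd z \<noteq> 0"
    proof
      assume "snd z = 0"
      then have "Re (F z) = 0" using F_axis[of "fst z"] by (metis prod.collapse im_axis_sel(1))
      then show False using w K_pos e by (auto simp: z_def)
    qed
    then have "z \<in> U \<union> D" using w(1) by (cases z) (auto simp: z_def U_def D_def strip_def)
    moreover have "e * Re (F z) > 0" using w e K_pos by (auto simp: z_def)
    ultimately show ?thesis by blast
  qed
  have mem: "(x, 1) \<in> U" "(x, -1) \<in> D" for x by (auto simp: U_def D_def)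
  have b: "\<bar>Re (F (x, 1))\<bar> = K * Im (F (x, 1))" "\<bar>Re (F (x, -1))\<bar> = K * Im (F (x, -1))" for x
    by (auto intro: F_boundary)
  show thesis
  proof (cases "\<forall>z\<in>U. Re (F z) > 0")
    case True
    then have "\<forall>z\<in>D. Re (F z) < 0" using D ex[of "-1"] by force
    then have "Re (F (x, -1)) < 0" for x using mem(2) by blast
    moreover have "Re (F (x, 1)) > 0" for x using True mem(1) by blast
    ultimately have "Re (F (x, 1)) =  (K * Im (F (x, 1)))" "Re (F (x, -1)) = - (K * Im (F (x, -1)))" for x
      using b[of x] by (metis abs_of_neg abs_of_pos minus_minus)+
    then show thesis by (intro that[of 1]) simp_all
  next
    case False
    then have n: "\<forall>z\<in>U. Re (F z) < 0" using U by blast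
    then have "\<forall>z\<in>D. Re (F z) > 0" using D ex[of 1] by force
    then have "Re (F (x, -1)) > 0" for x using mem(2) by blast
    moreover have "Re (F (x, 1)) < 0" for x using n mem(1) by blast
    ultimately have "Re (F (x, 1)) = - (K * Im (F (x, 1)))" "Re (F (x, -1)) =  (K * Im (F (x, -1)))" for x
      using b[of x] by (metis abs_of_neg abs_of_pos minus_minus)+
    then show thesis by (intro that[of "-1"]) simp_all
  qed
qed

subsection \<open>Geodesic representatives in a collar\<close>

text \<open>The homotopy lifts to the strip and develops to \<open>P\<close>. Its fixed ends lift to
  constant paths, so both paths of the developed homotopy have the same endpoints. Comparing one
  with \<open>G\<close> and the other with the developed segment costs one deck transformation
  each.\<close>

lemma homotopic_lift_endpoints:
  assumes hom: "homotopic_paths (h ` std_annulus) g (h \<circ> ann_cover \<circ> linepath z0 z1)"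
    and z: "z0 \<in> strip" "z1 \<in> strip"
    and G: "continuous_on {0..1} G" "\<And>s. s \<in> {0..1} \<Longrightarrow> G s \<in> H2" "\<And>s. s \<in> {0..1} \<Longrightarrow> q (G s) = g s"
  obtains f where "deck f" "G 0 = f (F z0)" "G 1 = f (F z1)"
proof -
  obtain H :: "real \<times> real \<Rightarrow> 'a" where H: "continuous_on ({0..1} \<times> {0..1}) H"
      "H \<in> {0..1} \<times> {0..1} \<rightarrow> h ` std_annulus"
    and H0: "\<And>x. x \<in> {0..1} \<Longrightarrow> H (0, x) = g x"
    and H1: "\<And>x. x \<in> {0..1} \<Longrightarrow> H (1, x) = (h \<circ> ann_cover \<circ> linepath z0 z1) x"
    and ends: "\<And>t. t \<in> {0..1} \<Longrightarrow> pathstart (H \<circ> Pair t) = pathstart g"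
      "\<And>t. t \<in> {0..1} \<Longrightarrow> pathfinish (H \<circ> Pair t) = pathfinish g"
    using hom unfolding homotopic_paths by blast
  obtain V :: "real \<times> real \<Rightarrow> real \<times> real" where V: "continuous_on ({0..1} \<times> {0..1}) V" "\<And>u. u \<in> {0..1} \<times> {0..1} \<Longrightarrow> V u \<in> strip"
    "\<And>u. u \<in> {0..1} \<times> {0..1} \<Longrightarrow> h (ann_cover (V u)) = H u"
  proof (rule annulus_lift[OF h _ H(1)])
    show "contractible ({0..1} \<times> {0..1} :: (real \<times> real) set)"
      by (intro convex_imp_contractible convex_Times) auto
  qed (use H(2) in auto)
  define P where "P = (\<lambda>u. F (V u))"
  have P: "continuous_on ({0..1} \<times> {0..1}) P"
    unfolding P_def by (rule continuous_on_compose2[OF F_cont V(1)]) (use V(2) in auto)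
  have PH: "P (s, t) \<in> H2" and qP: "q (P (s, t)) = H (s, t)" if "s \<in> {0..1}" "t \<in> {0..1}" for s t
    using that V(2,3)[of "(s, t)"] F_H2 q_F by (auto simp: P_def)
  have Pc1: "continuous_on {0..1} (\<lambda>t. P (s, t))" if "s \<in> {0..1}" for s
    by (rule continuous_on_compose2[OF P]) (use that in \<open>auto intro!: continuous_intros\<close>)
  have Pc2: "continuous_on {0..1} (\<lambda>s. P (s, t))" if "t \<in> {0..1}" for t
    by (rule continuous_on_compose2[OF P]) (use that in \<open>auto intro!: continuous_intros\<close>)
  note lin = linepath_in_strip[OF z]
  have end_const: "P (1, t) = P (0, t)" if t: "t = 0 \<or> t = 1" for t
  proof (rule lift_unique[of "{0..1}" "\<lambda>s. P (s, t)" "\<lambda>s. P (0, t)" 0 1])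
    have tI: "t \<in> {0..1}" using t by auto
    show "continuous_on {0..1} (\<lambda>s. P (s, t))" by (rule Pc2[OF tI])
    show "P (s, t) \<in> H2" "P (0, t) \<in> H2" if "s \<in> {0..1}" for s using PH that tI by auto
    show "q (P (s, t)) = q (P (0, t))" if "s \<in> {0..1}" for s
      using qP[OF that tI] qP[of 0 t] tI ends[OF that] ends[of 0] t
      by (auto simp: pathstart_def pathfinish_def)
  qed auto
  obtain f1 where f1: "deck f1" "\<And>t. t \<in> {0..1} \<Longrightarrow> G t = f1 (P (0, t))"
  proof (rule lift_deck[of "{0..1::real}" "\<lambda>t. P (0, t)" G])
    show "q (P (0, t)) = q (G t)" if "t \<in> {0..1}" for t
      using qP[of 0 t] that G(3)[OF that] H0[OF that] by simp
  qed (use Pc1 PH G in auto)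
  obtain f2 where f2: "deck f2" "\<And>t. t \<in> {0..1} \<Longrightarrow> P (1, t) = f2 (F (linepath z0 z1 t))"
  proof (rule lift_deck[of "{0..1::real}" "\<lambda>t. F (linepath z0 z1 t)" "\<lambda>t. P (1, t)"])
    show "continuous_on {0..1} (\<lambda>t. F (linepath z0 z1 t))"
      by (rule continuous_on_compose2[OF F_cont]) (use lin in \<open>auto intro: continuous_on_linepath\<close>)
    show "q (F (linepath z0 z1 t)) = q (P (1, t))" if "t \<in> {0..1}" for t
      using qP[of 1 t] that H1[OF that] q_F[OF lin[OF that]] by simp
  qed (use Pc1 PH lin F_H2 in auto)
  have lp: "linepath z0 z1 0 = z0" "linepath z0 z1 1 = z1" by (simp_all add: linepath_def)
  show thesis
  proof (rule that[OF deck_comp[OF f1(1) f2(1)]])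
    show "G 0 = (f1 \<circ> f2) (F z0)" using f1(2)[of 0] f2(2)[of 0] end_const[of 0] by (simp add: lp)
    show "G 1 = (f1 \<circ> f2) (F z1)" using f1(2)[of 1] f2(2)[of 1] end_const[of 1] by (simp add: lp)
  qed
qed

text \<open>The length is forced because, up to a deck transformation, any lift of a representative
  has the endpoints of the developed segment. For existence, \<open>sec\<close> pulls the geodesic
  back to the strip, whose convexity provides the straight-line homotopy.\<close>

lemma geodesic_rep_iff:
  assumes z: "z0 \<in> strip" "z1 \<in> strip"
  shows "(\<exists>g. geodesic_rep q h (h \<circ> ann_cover \<circ> linepath z0 z1) g D) \<longleftrightarrow> D = hdist (F z0) (F z1)"
proof
  assume "\<exists>g. geodesic_rep q h (h \<circ> ann_cover \<circ> linepath z0 z1) g D"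
  then obtain g \<sigma> where hom: "homotopic_paths (h ` std_annulus) g (h \<circ> ann_cover \<circ> linepath z0 z1)"
    and \<sigma>: "\<And>s. s \<in> {0..1} \<Longrightarrow> \<sigma> s \<in> H2" "\<And>s. s \<in> {0..1} \<Longrightarrow> q (\<sigma> s) = g s"
    and d: "\<And>s t. s \<in> {0..1} \<Longrightarrow> t \<in> {0..1} \<Longrightarrow> hdist (\<sigma> s) (\<sigma> t) = D * \<bar>s - t\<bar>"
    unfolding geodesic_rep_def geodesic_arc_def by blast
  have "continuous_on {0..1} \<sigma>"
    by (rule continuous_on_constant_speed[OF \<sigma>(1) d])
  then obtain f where f: "deck f" "\<sigma> 0 = f (F z0)" "\<sigma> 1 = f (F z1)"
    using homotopic_lift_endpoints[OF hom z _ \<sigma>] by blast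
  then have "hdist (F z0) (F z1) = hdist (\<sigma> 0) (\<sigma> 1)" using deckD(3) F_H2 z by simp
  then show "D = hdist (F z0) (F z1)" using d[of 0 1] by simp
next
  assume D: "D = hdist (F z0) (F z1)"
  obtain \<sigma> where \<sigma>: "\<sigma> 0 = F z0" "\<sigma> 1 = F z1" "\<And>s. s \<in> {0..1} \<Longrightarrow> \<sigma> s \<in> H2"
    and d: "\<And>s t. s \<in> {0..1} \<Longrightarrow> t \<in> {0..1} \<Longrightarrow> hdist (\<sigma> s) (\<sigma> t) = D * \<bar>s - t\<bar>"
    and cn: "\<And>s. s \<in> {0..1} \<Longrightarrow> \<sigma> s \<in> cone K"
    unfolding D using geodesic_segment[OF F_H2[OF z(1)] F_H2[OF z(2)]] F_cone[OF z(1)] F_cone[OF z(2)] by metis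
  have c\<sigma>: "continuous_on {0..1} \<sigma>"
    by (rule continuous_on_constant_speed[OF \<sigma>(3) d])
  define p where "p = sec \<circ> \<sigma>"
  have p: "path p" unfolding p_def path_def
    using c\<sigma> sec(1) cn by (intro continuous_on_compose) (auto intro: continuous_on_subset)
  have pstrip: "p s \<in> strip" and Fp: "F (p s) = \<sigma> s" if "s \<in> {0..1}" for s
    using sec(2,3)[OF cn[OF that]] by (auto simp: p_def)
  have pe: "p 0 = z0" "p 1 = z1"
    using F_inj[OF pstrip[of 0] z(1)] F_inj[OF pstrip[of 1] z(2)] Fp[of 0] Fp[of 1] \<sigma>(1,2) by auto
  have "homotopic_paths strip p (linepath z0 z1)"
  proof (rule homotopic_paths_linear[OF p path_linepath])
    show "closed_segment (p t) (linepath z0 z1 t) \<subseteq> strip" if "t \<in> {0..1}" for t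
    proof (rule closed_segment_subset[OF pstrip[OF that] _ convex_strip])
      show "linepath z0 z1 t \<in> strip"
        by (rule linepath_in_strip[OF z that])
    qed
  qed (auto simp: pathstart_def pathfinish_def pe linepath_def)
  then have "homotopic_paths (h ` std_annulus) ((h \<circ> ann_cover) \<circ> p) ((h \<circ> ann_cover) \<circ> linepath z0 z1)"
  proof (rule homotopic_paths_continuous_image)
    show "continuous_on strip (h \<circ> ann_cover)"
      unfolding o_def by (rule continuous_on_compose2[OF h(1) continuous_on_ann_cover]) (auto intro: ann_cover_annulus)
  qed (use ann_cover_annulus in auto)
  moreover have "geodesic_arc q (h \<circ> ann_cover \<circ> p) D"
    unfolding geodesic_arc_def using \<sigma>(3) d q_F[OF pstrip] Fp by (intro exI[of _ \<sigma>]) auto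
  ultimately show "\<exists>g. geodesic_rep q h (h \<circ> ann_cover \<circ> linepath z0 z1) g D"
    unfolding geodesic_rep_def by blast
qed

text \<open>Adding 1 to both sides makes each a doubled cosh: 2 cosh^2 (L/2) = (1 + K^2) * 2 cosh^2
  t, with 1 + K^2 = coth^2 a.\<close>

lemma half_length:
  assumes "cosh L = (1 + K\<^sup>2) * cosh (2 * t) + K\<^sup>2" "L \<ge> 0"
  shows "L = 2 * arcosh (cosh t * coth a)"
proof -
  have s: "sinh a > 0" using a_pos by simp
  have K1: "1 + K\<^sup>2 = (coth a)\<^sup>2"
    using s cosh_square_eq[of a] by (simp add: K_def coth_def power_divide field_simps)
  have "2 * (cosh (L / 2))\<^sup>2 = cosh L + 1"
    using cosh_double_cosh[of "L / 2"] by simp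
  also have "\<dots> = (1 + K\<^sup>2) * (cosh (2 * t) + 1)" using assms(1) by (simp add: algebra_simps)
  also have "\<dots> = 2 * (cosh t * coth a)\<^sup>2"
    unfolding K1 cosh_double_cosh by (simp add: power_mult_distrib)
  finally have "(cosh (L / 2))\<^sup>2 = (cosh t * coth a)\<^sup>2" by simp
  moreover have "coth a > 0" using s by (simp add: coth_def)
  ultimately have "cosh (L / 2) = cosh t * coth a"
    by (subst (asm) power2_eq_iff_nonneg) auto
  then have "L / 2 = arcosh (cosh t * coth a)" using assms(2) arcosh_cosh_real[of "L / 2"] by simp
  then show ?thesis by simp
qed

theorem triangle_lengths:
  assumes \<beta>: "geodesic_rep q h (beta_path h) \<beta> d"
    and \<beta>': "path \<beta>'" "path_image \<beta>' \<subseteq> strip" "\<And>s. s \<in> {0..1} \<Longrightarrow> h (ann_cover (\<beta>' s)) = \<beta> s"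
    and feet: "cmod (F (pathstart \<beta>')) = exp s0" "cmod (F (pathfinish \<beta>')) = exp s1"
    and twist: "s1 - s0 = - (2 * \<tau>)"
  shows "hyp_triangle_lengths q h (l, b, c') \<longleftrightarrow>
    l = a \<and> b = arcosh (cosh \<tau> * coth a) \<and> c' = arcosh (cosh (a - \<tau>) * coth a)"
proof -
  have st: "(x, 1) \<in> strip" "(x, -1) \<in> strip" for x by (auto simp: strip_def)
  have bp: "beta_path h = h \<circ> ann_cover \<circ> linepath (1, -1) (1, 1)"
    by (auto simp: beta_path_def linepath_def algebra_simps)
  have gp: "gamma_path h = h \<circ> ann_cover \<circ> linepath (-1, -1) (1, 1)"
    by (auto simp: gamma_path_def linepath_def algebra_simps)
  have \<beta>s: "\<beta>' s \<in> strip" if "s \<in> {0..1}" for s using \<beta>'(2) that by (auto simp: path_image_def)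
  have hom: "homotopic_paths (h ` std_annulus) \<beta> (h \<circ> ann_cover \<circ> linepath (1, -1) (1, 1))"
    using \<beta> by (simp add: geodesic_rep_def bp)
  obtain f where f: "deck f" "F (\<beta>' 0) = f (F (1, -1))" "F (\<beta>' 1) = f (F (1, 1))"
  proof (rule homotopic_lift_endpoints[OF hom st(2) st(1), of "\<lambda>s. F (\<beta>' s)"])
    show "continuous_on {0..1} (\<lambda>s. F (\<beta>' s))"
      by (rule continuous_on_compose2[OF F_cont]) (use \<beta>' in \<open>auto simp: path_def path_image_def\<close>)
  qed (use \<beta>s F_H2 q_F \<beta>'(3) in auto)
  have "h (ann_cover (\<beta>' 0)) = h (ann_cover (1, -1))"
    using q_F[OF \<beta>s[of 0]] q_F[OF st(2)[of 1]] f(2) deckD(2)[OF f(1) F_H2[OF st(2)]] by simp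
  then obtain k where k: "\<beta>' 0 = shift k (1, -1)" using h_ann_cover_eqD[OF \<beta>s[of 0] st(2)[of 1]] by auto
  \<comment> \<open>The lift \<open>\<beta>'\<close> is arbitrary, so its endpoints develop
    correctly only up to \<open>f\<close>. Identifying \<open>f\<close> with a shift makes its
    effect on moduli the factor exp (k c).\<close>
  have fF: "f (F z) = F (shift k z)" if "z \<in> strip" for z
  proof (rule lift_unique[of strip "\<lambda>z. f (F z)" "\<lambda>z. F (shift k z)" "(1, -1)"])
    show "continuous_on strip (\<lambda>z. f (F z))"
      by (rule continuous_on_compose2[OF deckD(4)[OF f(1)] F_cont]) (use F_H2 in auto)
    show "f (F (1, -1)) = F (shift k (1, -1))" using f(2) k by simp
  qed (use connected_strip F_shift_cont F_H2 deckD[OF f(1)] q_F h_ann_cover_shift st that in auto)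
  \<comment> \<open>The feet for the lift from (1, -1): undoing the shift subtracts the same amount
    from both and preserves their displacement.\<close>
  define p where "p = s0 - of_int k * c"
  define r where "r = s1 - of_int k * c"
  have p: "cmod (F (1, -1)) = exp p"
    using feet(1) f(2) fF[OF st(2)] F_shift(1)[OF st(2), of k 1]
    by (simp add: pathstart_def p_def exp_diff field_simps)
  have r: "cmod (F (1, 1)) = exp r"
    using feet(2) f(3) fF[OF st(1)] F_shift(1)[OF st(1), of k 1]
    by (simp add: pathfinish_def r_def exp_diff field_simps)
  have rp: "r - p = - (2 * \<tau>)" using twist by (simp add: r_def p_def)
  \<comment> \<open>The path of \<gamma> starts one turn earlier than that of \<beta>, which moves
    its initial foot back by c = 2 a.\<close>
  have "shift (-1) (1, -1) = (-1, -1)" by (simp add: shift_def)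
  then have p': "cmod (F (-1, -1)) = exp (p - 2 * a)"
    using F_shift(1)[OF st(2), of "-1" 1] p by (simp add: c_eq exp_diff exp_minus field_simps)
  obtain e where e: "e * e = 1" "\<And>x. Re (F (x, 1)) = e * K * Im (F (x, 1))"
    "\<And>x. Re (F (x, -1)) = - e * K * Im (F (x, -1))" using F_opposite_sides by blast
  have "cosh (hdist (F (1, 1)) (F (1, -1))) = (1 + K\<^sup>2) * cosh (r - p) + K\<^sup>2"
    by (rule hdist_across_cone[OF F_H2[OF st(1)] F_H2[OF st(2)] e(2,3,1) r p])
  then have "cosh (hdist (F (1, -1)) (F (1, 1))) = (1 + K\<^sup>2) * cosh (2 * \<tau>) + K\<^sup>2"
    by (simp add: hdist_sym rp)
  then have b: "hdist (F (1, -1)) (F (1, 1)) = 2 * arcosh (cosh \<tau> * coth a)"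
    by (rule half_length) (simp add: hdist_nonneg F_H2 st)
  have "cosh (hdist (F (1, 1)) (F (-1, -1))) = (1 + K\<^sup>2) * cosh (r - (p - 2 * a)) + K\<^sup>2"
    by (rule hdist_across_cone[OF F_H2[OF st(1)] F_H2[OF st(2)] e(2,3,1) r p'])
  moreover have "r - (p - 2 * a) = 2 * (a - \<tau>)" using rp by simp
  ultimately have "cosh (hdist (F (-1, -1)) (F (1, 1))) = (1 + K\<^sup>2) * cosh (2 * (a - \<tau>)) + K\<^sup>2"
    by (simp only: hdist_sym)
  then have c: "hdist (F (-1, -1)) (F (1, 1)) = 2 * arcosh (cosh (a - \<tau>) * coth a)"
    by (rule half_length) (simp add: hdist_nonneg F_H2 st)
  have "closed_geodesic q (h ` ann_circle 0) (2 * l) \<longleftrightarrow> l = a"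
  proof
    assume "closed_geodesic q (h ` ann_circle 0) (2 * l)"
    then show "l = a" using closed_geodesic_length[of "2 * l"] c_eq by linarith
  qed (use core in simp)
  then show ?thesis
    unfolding hyp_triangle_lengths_def prod.case bp gp geodesic_rep_iff[OF st(2) st(1)] b c by auto
qed

end

subsection \<open>Change of the developing map by an isometry\<close>

lemma closed_geodesic_isometry:
  assumes f: "H2_isometry f" "\<And>z. z \<in> H2 \<Longrightarrow> q' (f z) = q z" and cg: "closed_geodesic q C L"
  shows "closed_geodesic q' C L"
proof -
  obtain \<sigma> where L: "L > 0" and \<sigma>: "geodesic_line \<sigma>" and C: "C = range (q \<circ> \<sigma>)"
    and per: "\<And>s t. q (\<sigma> s) = q (\<sigma> t) \<longleftrightarrow> (\<exists>k::int. s - t = of_int k * L)"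
    using cg unfolding closed_geodesic_def by blast
  have H: "\<sigma> s \<in> H2" for s using \<sigma> by (auto simp: geodesic_line_def)
  have "geodesic_line (f \<circ> \<sigma>)"
    using \<sigma> H H2_isometryD[OF f(1)] by (auto simp: geodesic_line_def)
  moreover have e: "q' (f (\<sigma> s)) = q (\<sigma> s)" for s using f(2)[OF H] .
  then have "C = range (q' \<circ> (f \<circ> \<sigma>))" by (simp add: C o_def)
  ultimately show ?thesis
    unfolding closed_geodesic_def using L per e by (intro conjI exI[of _ "f \<circ> \<sigma>"]) auto
qed

lemma geodesic_arc_isometry:
  assumes f: "H2_isometry f" "\<And>z. z \<in> H2 \<Longrightarrow> q' (f z) = q z" and ga: "geodesic_arc q g L"
  shows "geodesic_arc q' g L"
proof -
  obtain \<sigma> where \<sigma>: "\<And>s. s \<in> {0..1} \<Longrightarrow> \<sigma> s \<in> H2 \<and> q (\<sigma> s) = g s"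
    "\<And>s t. s \<in> {0..1} \<Longrightarrow> t \<in> {0..1} \<Longrightarrow> hdist (\<sigma> s) (\<sigma> t) = L * \<bar>s - t\<bar>"
    using ga unfolding geodesic_arc_def by blast
  show ?thesis unfolding geodesic_arc_def
    by (rule exI[of _ "f \<circ> \<sigma>"]) (use \<sigma> f(2) H2_isometryD[OF f(1)] in auto)
qed

lemma hyp_triangle_lengths_isometry:
  assumes f: "H2_isometry f" "\<And>z. z \<in> H2 \<Longrightarrow> q' (f z) = q z" and tl: "hyp_triangle_lengths q h abc"
  shows "hyp_triangle_lengths q' h abc"
  using tl closed_geodesic_isometry[of f q' q, OF f] geodesic_arc_isometry[of f q' q, OF f]
  unfolding hyp_triangle_lengths_def geodesic_rep_def by (cases abc) blast

lemma surface_dist_isometry: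
  assumes f: "H2_isometry f" "\<And>z. z \<in> H2 \<Longrightarrow> q' (f z) = q z"
  shows "surface_dist q' x y = surface_dist q x y"
proof -
  obtain f' where f': "H2_isometry f'" "\<And>z. z \<in> H2 \<Longrightarrow> f (f' z) = z"
    using H2_isometry_inverse[OF f(1)] by metis
  have "{hdist z w | z w. z \<in> H2 \<and> w \<in> H2 \<and> q' z = x \<and> q' w = y}
      = {hdist z w | z w. z \<in> H2 \<and> w \<in> H2 \<and> q z = x \<and> q w = y}" (is "?A = ?B")
  proof
    show "?A \<subseteq> ?B"
    proof clarify
      fix z w assume zw: "z \<in> H2" "w \<in> H2"
      have "hdist z w = hdist (f' z) (f' w) \<and> f' z \<in> H2 \<and> f' w \<in> H2 \<and> q (f' z) = q' z \<and> q (f' w) = q' w"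
        using zw H2_isometryD[OF f'(1)] f(2)[of "f' z"] f(2)[of "f' w"] f'(2) by simp
      then show "\<exists>z' w'. hdist z w = hdist z' w' \<and> z' \<in> H2 \<and> w' \<in> H2 \<and> q z' = q' z \<and> q w' = q' w"
        by blast
    qed
    show "?B \<subseteq> ?A"
    proof clarify
      fix z w assume zw: "z \<in> H2" "w \<in> H2"
      have "hdist z w = hdist (f z) (f w) \<and> f z \<in> H2 \<and> f w \<in> H2 \<and> q' (f z) = q z \<and> q' (f w) = q w"
        using zw H2_isometryD[OF f(1)] f(2) by simp
      then show "\<exists>z' w'. hdist z w = hdist z' w' \<and> z' \<in> H2 \<and> w' \<in> H2 \<and> q' z' = q z \<and> q' w' = q w"
        by blast
    qed
  qed
  then show ?thesis by (simp add: surface_dist_def)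
qed

lemma hyperbolic_metric_isometry:
  assumes f: "H2_isometry f" and q: "hyperbolic_metric S q"
  shows "hyperbolic_metric S (q \<circ> f)"
proof -
  obtain f' where f': "H2_isometry f'" "\<And>z. z \<in> H2 \<Longrightarrow> f' (f z) = z" "\<And>z. z \<in> H2 \<Longrightarrow> f (f' z) = z"
    by (rule H2_isometry_inverse[OF f], rule that)
  note fD = H2_isometryD[OF f] and f'D = H2_isometryD[OF f'(1)]
  have "homeomorphism H2 H2 f f'"
    by (rule homeomorphismI) (use H2_isometry_continuous f f' fD f'D in auto)
  then have cov: "covering_space H2 (q \<circ> f) S"
    using covering_space_homeomorphism_comp q by (auto simp: hyperbolic_metric_def)
  have "\<exists>k. H2_isometry k \<and> (\<forall>u\<in>H2. (q \<circ> f) (k u) = (q \<circ> f) u) \<and> k z = w"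
    if "z \<in> H2" "w \<in> H2" "(q \<circ> f) z = (q \<circ> f) w" for z w
  proof -
    have "f z \<in> H2" "f w \<in> H2" "q (f z) = q (f w)" using that fD by auto
    then obtain k where k: "H2_isometry k" "\<forall>u\<in>H2. q (k u) = q u" "k (f z) = f w"
      using q unfolding hyperbolic_metric_def by blast
    \<comment> \<open>The deck group of q \<circ> f is the conjugate by \<open>f\<close> of that of
      \<open>q\<close>.\<close>
    have "H2_isometry (f' \<circ> k \<circ> f)" by (intro H2_isometry_comp f f' k)
    moreover have "(q \<circ> f) ((f' \<circ> k \<circ> f) u) = (q \<circ> f) u" if "u \<in> H2" for u
      using k(2) f'(3) fD that H2_isometryD(1)[OF k(1)] by simp
    moreover have "(f' \<circ> k \<circ> f) z = w" using k(3) f'(2) that by simp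
    ultimately show ?thesis by blast
  qed
  then show ?thesis using cov by (simp add: hyperbolic_metric_def)
qed

theorem hyperbolic_triangle_lengths:
  fixes h :: "complex \<times> real \<Rightarrow> 'a::t2_space"
  assumes q: "hyperbolic_metric S q"
    and h: "continuous_on std_annulus h" "inj_on h std_annulus"
    and core: "closed_geodesic q (h ` ann_circle 0) (2 * a')"
    and collar: "h ` std_annulus = {x \<in> S. \<exists>y \<in> h ` ann_circle 0. surface_dist q x y \<le> collar_width a'}"
    and fn: "fenchel_nielsen q h (2 * l, 2 * \<tau>)"
  shows "hyp_triangle_lengths q h (a, b, c) \<longleftrightarrow>
    a = l \<and> b = arcosh (cosh \<tau> * coth l) \<and> c = arcosh (cosh (l - \<tau>) * coth l)"
proof -
  have cl: "closed_geodesic q (h ` ann_circle 0) (2 * l)" using fn by (simp add: fenchel_nielsen_def)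
  obtain \<beta> d F \<beta>' \<sigma> \<theta> s0 s1 where
    rep: "geodesic_rep q h (beta_path h) \<beta> d"
    and F: "continuous_on strip F" "\<forall>z\<in>strip. F z \<in> H2 \<and> q (F z) = h (ann_cover z)"
    and \<beta>': "path \<beta>'" "path_image \<beta>' \<subseteq> strip" "\<forall>s\<in>{0..1}. h (ann_cover (\<beta>' s)) = \<beta> s"
    and \<sigma>: "geodesic_line \<sigma>" and \<theta>: "strict_mono \<theta>" "surj \<theta>" "\<forall>x. F (x, 0) = \<sigma> (\<theta> x)"
    and feet: "perpendicular_foot \<sigma> (F (pathstart \<beta>')) s0" "perpendicular_foot \<sigma> (F (pathfinish \<beta>')) s1"
    and twist: "s1 - s0 = - (2 * \<tau>)"
    using fn unfolding fenchel_nielsen_def prod.case by (elim exE conjE) (rule that)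
  obtain a1 b1 c1 d1 where det: "a1 * d1 - b1 * c1 = 1" and \<sigma>M: "\<And>t. \<sigma> t = real_moebius a1 b1 c1 d1 (im_axis t)"
    by (rule geodesic_line_moebius[OF \<sigma>], rule that)
  define M where "M = real_moebius a1 b1 c1 d1"
  have M: "H2_isometry M" unfolding M_def by (rule real_moebius_isometry[OF det])
  obtain N where N: "H2_isometry N" "\<And>z. z \<in> H2 \<Longrightarrow> N (M z) = z" "\<And>z. z \<in> H2 \<Longrightarrow> M (N z) = z"
    by (rule H2_isometry_inverse[OF M], rule that)
  note ND = H2_isometryD[OF N(1)]
  \<comment> \<open>Since \<open>M\<close> carries the imaginary axis to \<open>\<sigma>\<close>,
    replacing \<open>q\<close> by q \<circ> M and \<open>F\<close> by N \<circ> F describes the same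
    metric with the core on the imaginary axis.\<close>
  define q' where "q' = q \<circ> M"
  have q'N: "q' (N z) = q z" if "z \<in> H2" for z using N(3)[OF that] by (simp add: q'_def)
  have qM: "q (M z) = q' z" if "z \<in> H2" for z by (simp add: q'_def)
  define F' where "F' = N \<circ> F"
  interpret hyperbolic_surface S q'
    by unfold_locales (use hyperbolic_metric_isometry[OF M q] in \<open>simp add: q'_def\<close>)
  interpret developed_collar S q' h F' \<theta> a'
  proof
    show "closed_geodesic q' (h ` ann_circle 0) (2 * a')"
      by (rule closed_geodesic_isometry[of N q' q, OF N(1) q'N core])
    show "h ` std_annulus = {x \<in> S. \<exists>y\<in>h ` ann_circle 0. surface_dist q' x y \<le> collar_width a'}"
      using collar surface_dist_isometry[of N q' q, OF N(1) q'N] by simp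
    show "continuous_on strip F'"
      unfolding F'_def using F H2_isometry_continuous[OF N(1)]
      by (intro continuous_on_compose) (auto intro: continuous_on_subset)
    show "F' z \<in> H2" "q' (F' z) = h (ann_cover z)" if "z \<in> strip" for z
      using F(2) that ND(1) q'N by (auto simp: F'_def)
    show "F' (x, 0) = im_axis (\<theta> x)" for x
      using \<theta>(3) N(2) by (simp add: F'_def \<sigma>M M_def)
  qed (use h \<theta> in auto)
  have foot: "cmod (F' z) = exp s" if "z \<in> strip" "perpendicular_foot \<sigma> (F z) s" for z s
  proof -
    have "F z \<in> H2" using F(2) that(1) by blast
    then have "F z = real_moebius a1 b1 c1 d1 (F' z)" "F' z \<in> H2"
      using N(3)[of "F z"] ND(1) by (auto simp: F'_def M_def)
    then show ?thesis using perpendicular_foot_axis[OF det \<sigma>M] that(2) by simp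
  qed
  have ends: "pathstart \<beta>' \<in> strip" "pathfinish \<beta>' \<in> strip" using \<beta>'(2) by auto
  \<comment> \<open>The collar and the Fenchel-Nielsen coordinates each bring a half length of the
    core; both equal half of its period.\<close>
  have "a' = l"
    using closed_geodesic_length[OF closed_geodesic_isometry[of N q' q, OF N(1) q'N cl]] c_eq by simp
  moreover have "geodesic_rep q' h (beta_path h) \<beta> d"
    using rep geodesic_arc_isometry[of N q' q, OF N(1) q'N] by (simp add: geodesic_rep_def)
  then have "hyp_triangle_lengths q' h (a, b, c) \<longleftrightarrow>
      a = a' \<and> b = arcosh (cosh \<tau> * coth a') \<and> c = arcosh (cosh (a' - \<tau>) * coth a')"
    by (rule triangle_lengths[OF _ \<beta>'(1,2) _ foot[OF ends(1) feet(1)] foot[OF ends(2) feet(2)] twist])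
      (use \<beta>'(3) in auto)
  moreover have "hyp_triangle_lengths q' h (a, b, c) \<longleftrightarrow> hyp_triangle_lengths q h (a, b, c)"
    using hyp_triangle_lengths_isometry[of M q q', OF M qM] hyp_triangle_lengths_isometry[of N q' q, OF N(1) q'N] by blast
  ultimately show ?thesis by simp
qed

subsection \<open>Measured foliations\<close>

lemma integral_form_along_linepath:
  "integral {0..1} (form_along u v (linepath z w)) = u * (fst w - fst z) + v * (snd w - snd z)"
  "integral {0..1} (\<lambda>s. \<bar>form_along u v (linepath z w) s\<bar>) = \<bar>u * (fst w - fst z) + v * (snd w - snd z)\<bar>"
  by (simp_all add: form_along_def[abs_def])

lemma covered_by_form_linepath:
  assumes "covered_by_form h \<mu> u v" "z \<in> strip" "w \<in> strip"
  shows "\<mu> (h \<circ> ann_cover \<circ> linepath z w) = ereal \<bar>u * (fst w - fst z) + v * (snd w - snd z)\<bar>"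
proof -
  have "path_image (linepath z w) \<subseteq> strip"
    using assms by (simp add: closed_segment_subset convex_strip)
  then show ?thesis
    using assms(1) unfolding covered_by_form_def
    by (simp add: integral_form_along_linepath)
qed

theorem foliation_triangle_lengths:
  assumes cov: "covered_by_form h \<mu> u0 v0" and l: "l \<ge> 0" and dt: "dehn_thurston \<mu> h (2 * l, 2 * \<tau>)"
  shows "mf_triangle_lengths \<mu> h (a, b, c) \<longleftrightarrow> a = l \<and> b = \<bar>\<tau>\<bar> \<and> c = \<bar>l - \<tau>\<bar>"
proof -
  have lin: "(\<lambda>s. h (ann_cover (2 * s, 0))) = h \<circ> ann_cover \<circ> linepath (0, 0) (2, 0)"
    "(\<lambda>s. h (ann_cover (1, 2 * s - 1))) = h \<circ> ann_cover \<circ> linepath (1, -1) (1, 1)"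
    "(\<lambda>s. (1, 2 * s - 1)) = linepath (1::real, -1::real) (1, 1)"
    "(\<lambda>s. h (ann_cover (s, 0))) = h \<circ> ann_cover \<circ> linepath (0, 0) (1, 0)"
    "(\<lambda>s. h (ann_cover (1, s))) = h \<circ> ann_cover \<circ> linepath (1, 0) (1, 1)"
    "(\<lambda>s. h (ann_cover (s, s))) = h \<circ> ann_cover \<circ> linepath (0, 0) (1, 1)"
    by (auto simp: linepath_def algebra_simps)
  have st: "(x, 0) \<in> strip" "(x, 1) \<in> strip" "(x, -1) \<in> strip" for x by (auto simp: strip_def)
  obtain u v where uv: "covered_by_form h \<mu> u v" "\<bar>u\<bar> = l" "\<bar>v\<bar> = \<bar>\<tau>\<bar>" "\<bar>u + v\<bar> = \<bar>l - \<tau>\<bar>"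
  proof -
    have val: "\<bar>u\<bar> = l" "\<bar>v\<bar> = \<bar>\<tau>\<bar>" if "covered_by_form h \<mu> u v" for u v
      using dt covered_by_form_linepath[OF that, of "(0, 0)" "(2, 0)"]
        covered_by_form_linepath[OF that, of "(1, -1)" "(1, 1)"] st
      unfolding dehn_thurston_def prod.case lin by (auto simp: abs_mult)
    \<comment> \<open>The moduli of u and v do not determine |u + v|. For l = 0 they do, as u = 0;
      for l > 0 the sign convention provides a form with u = l and v = -\<tau>.\<close>
    show thesis
    proof (cases "l = 0")
      case True
      then show thesis using that[OF cov] val[OF cov] by simp
    next
      case False
      then obtain u v where uv: "covered_by_form h \<mu> u v" "u > 0"
        "integral {0..1} (form_along u v (linepath (1, -1) (1, 1))) = - (2 * \<tau>)"
        using l dt unfolding dehn_thurston_def prod.case lin by auto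
      have "v = - \<tau>" using uv(3) by (simp add: integral_form_along_linepath)
      moreover have "u = l" using val(1)[OF uv(1)] uv(2) by simp
      ultimately show thesis using that[OF uv(1)] l by simp
    qed
  qed
  show ?thesis
    unfolding mf_triangle_lengths_def prod.case lin
      covered_by_form_linepath[OF uv(1) st(1) st(1)] covered_by_form_linepath[OF uv(1) st(1) st(2)]
    by (auto simp: uv)
qed

theorem proposition4p1:
  fixes S :: "'a::t2_space set"
    and g n m i :: nat
    and h :: "nat \<Rightarrow> complex \<times> real \<Rightarrow> 'a"
    and Q :: "nat \<Rightarrow> complex \<Rightarrow> 'a"
  assumes "closed_orientable_surface S g" and "g \<ge> 2"
    and "pants_decomposition S n h m Q" and "i < n"
  shows "(\<forall>(q :: complex \<Rightarrow> 'a) (l::real) (\<tau>::real).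
            standard_hyperbolic_metric S n h m Q q \<and> l > 0 \<and>
            fenchel_nielsen q (h i) (2 * l, 2 * \<tau>) \<longrightarrow>
            (\<forall>a b c. hyp_triangle_lengths q (h i) (a, b, c) \<longleftrightarrow>
               a = l \<and>
               b = arcosh (cosh \<tau> * coth l) \<and>
               c = arcosh (cosh (l - \<tau>) * coth l)) \<and>
            (\<forall>x y. hyp_collar_parameters q (h i) (x, y) \<longleftrightarrow>
               x = 4 * l - 2 * arcosh (cosh \<tau> * coth l)
                         - 2 * arcosh (cosh (l - \<tau>) * coth l) \<and>
               y = 2 * arcosh (cosh \<tau> * coth l)
                   - 2 * arcosh (cosh (l - \<tau>) * coth l))) \<and>
         (\<forall>(\<mu> :: (real \<Rightarrow> 'a) \<Rightarrow> ereal) (l::real) (\<tau>::real).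
            standard_measured_foliation S n h m Q \<mu> \<and> l \<ge> 0 \<and>
            dehn_thurston \<mu> (h i) (2 * l, 2 * \<tau>) \<longrightarrow>
            (\<forall>a b c. mf_triangle_lengths \<mu> (h i) (a, b, c) \<longleftrightarrow>
               a = l \<and> b = \<bar>\<tau>\<bar> \<and> c = \<bar>l - \<tau>\<bar>) \<and>
            (\<forall>x y. mf_collar_parameters \<mu> (h i) (x, y) \<longleftrightarrow>
               x = 4 * l - 2 * \<bar>\<tau>\<bar> - 2 * \<bar>l - \<tau>\<bar> \<and>
               y = 2 * \<bar>\<tau>\<bar> - 2 * \<bar>l - \<tau>\<bar>))"
proof (intro conjI allI impI; elim conjE)
  fix q :: "complex \<Rightarrow> 'a" and l \<tau> :: real
  assume q: "standard_hyperbolic_metric S n h m Q q" and fn: "fenchel_nielsen q (h i) (2 * l, 2 * \<tau>)"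
  have h: "continuous_on std_annulus (h i)" "inj_on (h i) std_annulus"
    using assms(3,4) by (simp_all add: pants_decomposition_def)
  have "hyperbolic_metric S q"
    and "\<exists>a. closed_geodesic q (h i ` ann_circle 0) (2 * a) \<and>
      h i ` std_annulus = {x \<in> S. \<exists>y \<in> h i ` ann_circle 0. surface_dist q x y \<le> collar_width a}"
    using q assms(4) by (simp_all add: standard_hyperbolic_metric_def)
  then show *: "hyp_triangle_lengths q (h i) (a, b, c) \<longleftrightarrow>
      a = l \<and> b = arcosh (cosh \<tau> * coth l) \<and> c = arcosh (cosh (l - \<tau>) * coth l)" for a b c
    using hyperbolic_triangle_lengths[OF _ h _ _ fn] by blast
  show "hyp_collar_parameters q (h i) (x, y) \<longleftrightarrow>
      x = 4 * l - 2 * arcosh (cosh \<tau> * coth l) - 2 * arcosh (cosh (l - \<tau>) * coth l) \<and>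
      y = 2 * arcosh (cosh \<tau> * coth l) - 2 * arcosh (cosh (l - \<tau>) * coth l)" for x y
    by (simp add: hyp_collar_parameters_def collar_map_def *)
next
  fix \<mu> :: "(real \<Rightarrow> 'a) \<Rightarrow> ereal" and l \<tau> :: real
  assume \<mu>: "standard_measured_foliation S n h m Q \<mu>" and l: "0 \<le> l"
    and dt: "dehn_thurston \<mu> (h i) (2 * l, 2 * \<tau>)"
  obtain u v where "covered_by_form (h i) \<mu> u v"
    using \<mu> assms(4) unfolding standard_measured_foliation_def by blast
  then show *: "mf_triangle_lengths \<mu> (h i) (a, b, c) \<longleftrightarrow> a = l \<and> b = \<bar>\<tau>\<bar> \<and> c = \<bar>l - \<tau>\<bar>" for a b c
    by (rule foliation_triangle_lengths[OF _ l dt])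
  show "mf_collar_parameters \<mu> (h i) (x, y) \<longleftrightarrow>
      x = 4 * l - 2 * \<bar>\<tau>\<bar> - 2 * \<bar>l - \<tau>\<bar> \<and> y = 2 * \<bar>\<tau>\<bar> - 2 * \<bar>l - \<tau>\<bar>" for x y
    by (simp add: mf_collar_parameters_def collar_map_def *)
qed

end
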